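(* Let $B\subset\mathbb{R}^3$ be the unit ball centered at the origin, let $k>0$, and let $(\mathcal{K}_B^k)^*$ be the Neumann-Poincaré operator of $B$ for the Helmholtz operator $\Delta+k^2$. Then for all integers $n\ge 0$ and $-n\le m\le n$, $$(\mathcal{K}_B^k)^*[Y_n^m]=\frac{ik}{2}\big(j_n(k)\,h_n^{(1)}(k)+c_{n,k}\big)Y_n^m,$$ where $$c_{n,k}:=-\frac12\int_{-1}^1 e^{ik\sqrt{2(1-t)}}\,P_n(t)\,dt .$$
   Context: For $k>0$ put $G_k(\mathbf{x})=-\dfrac{e^{ik|\mathbf{x}|}}{4\pi|\mathbf{x}|}$, $\mathbf{x}\in\mathbb{R}^3\setminus\{0\}$. The Neumann-Poincaré operator $(\mathcal{K}_B^k)^*:H^{-1/2}(\partial B)\to H^{-1/2}(\partial B)$ is $$(\mathcal{K}_B^k)^*[\phi](\mathbf{x})=\mathrm{p.v.}\int_{\partial B}\frac{\partial G_k(\mathbf{x}-\mathbf{y})}{\partial\nu_{\mathbf{x}}}\,\phi(\mathbf{y})\,ds_{\mathbf{y}},\qquad \mathbf{x}\in\partial B,$$ where $\nu$ is the exterior unit normal to $\partial B$, the normal derivative is taken in $\mathbf{x}$, and p.v. denotes the Cauchy principal value. $Y_n^m$ are the spherical harmonics of order $n$ and degree $m$ on $\partial B=\mathbb{S}^2$, and $P_n$ is the Legendre polynomial of order $n$ (normalized by $P_n(1)=1$). $j_n$ and $y_n$ are the standard spherical Bessel and spherical Neumann functions of order $n$, and $h_n^{(1)}=j_n+iy_n$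 is the spherical Hankel function of the first kind. *)

theory Defs
  imports
    "HOL-Analysis.Analysis"
    "HOL-Computational_Algebra.Polynomial"
begin

section \<open>Surface integration and principal values on the unit sphere\<close>

definition spherical_coords :: "real \<times> real \<Rightarrow> real^3" where
  "spherical_coords = (\<lambda>(\<theta>, \<phi>). vector [sin \<theta> * cos \<phi>, sin \<theta> * sin \<phi>, cos \<theta>])"

(* The surface measure ds, as a Borel measure on real^3 carried by the unit sphere:
   the image under spherical coordinates of the area element sin(theta) dtheta dphi. *)
definition sphere_measure :: "(real^3) measure" where
  "sphere_measure =
     distr (density lborel (\<lambda>(\<theta>, \<phi>). indicator ({0..pi} \<times> {0..2 * pi}) (\<theta>, \<phi>) * ennreal (sin \<theta>)))
       borel spherical_coords"

definition pv_region :: "real^3 \<Rightarrow> real \<Rightarrow> (real^3) set" where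
  "pv_region x \<epsilon> = {y \<in> sphere 0 1. \<epsilon> \<le> dist x y}"

definition pv_integral :: "(real^3 \<Rightarrow> complex) \<Rightarrow> real^3 \<Rightarrow> complex" where
  "pv_integral f x = Lim (at_right 0) (\<lambda>\<epsilon>. LINT y:pv_region x \<epsilon>|sphere_measure. f y)"

(* Lebesgue integrals and Lim are total functions; this says that neither is used outside
   its domain of definition in pv_integral. *)
definition pv_exists :: "(real^3 \<Rightarrow> complex) \<Rightarrow> real^3 \<Rightarrow> bool" where
  "pv_exists f x \<longleftrightarrow>
     (\<forall>\<epsilon>>0. set_integrable sphere_measure (pv_region x \<epsilon>) f) \<and>
     (\<exists>l. ((\<lambda>\<epsilon>. LINT y:pv_region x \<epsilon>|sphere_measure. f y) \<longlongrightarrow> l) (at_right 0))"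


section \<open>The Neumann-Poincare operator of the unit ball\<close>

definition helmholtz_G :: "real \<Rightarrow> real^3 \<Rightarrow> complex" where
  "helmholtz_G k x = - exp (\<i> * of_real (k * norm x)) / of_real (4 * pi * norm x)"

(* The exterior unit normal of the unit ball at a point x of its boundary. *)
definition unit_ball_normal :: "real^3 \<Rightarrow> real^3" where
  "unit_ball_normal x = x"

(* Derivative of G_k(x - y) in the variable x along the exterior normal at x. *)
definition np_kernel :: "real \<Rightarrow> real^3 \<Rightarrow> real^3 \<Rightarrow> complex" where
  "np_kernel k x y = frechet_derivative (\<lambda>z. helmholtz_G k (z - y)) (at x) (unit_ball_normal x)"

definition np_operator :: "real \<Rightarrow> (real^3 \<Rightarrow> complex) \<Rightarrow> real^3 \<Rightarrow> complex" where
  "np_operator k \<phi> x = pv_integral (\<lambda>y. np_kernel k x y * \<phi> y) x"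

definition np_defined_at :: "real \<Rightarrow> (real^3 \<Rightarrow> complex) \<Rightarrow> real^3 \<Rightarrow> bool" where
  "np_defined_at k \<phi> x \<longleftrightarrow> pv_exists (\<lambda>y. np_kernel k x y * \<phi> y) x"


section \<open>Legendre polynomials and spherical harmonics\<close>

(* Rodrigues' formula, normalised by P_n(1) = 1. *)
definition legendre_poly :: "nat \<Rightarrow> real poly" where
  "legendre_poly n = smult (1 / (2 ^ n * fact n)) ((pderiv ^^ n) ([:-1, 0, 1:] ^ n))"

definition assoc_legendre :: "nat \<Rightarrow> nat \<Rightarrow> real \<Rightarrow> real" where
  "assoc_legendre n m t = sqrt (1 - t\<^sup>2) ^ m * poly ((pderiv ^^ m) (legendre_poly n)) t"

(* Y_n^m at a point x of the unit sphere, L2-normalised, without the Condon-Shortley sign.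
   For x with polar angle theta and azimuth phi one has cos(theta) = x$3, and Arg(x$1 + i x$2)
   is phi up to 2 pi.  At the poles phi is arbitrary, and either m = 0 or the associated
   Legendre factor vanishes. *)
definition sph_harmonic :: "nat \<Rightarrow> int \<Rightarrow> real^3 \<Rightarrow> complex" where
  "sph_harmonic n m x =
     of_real (sqrt ((2 * real n + 1) / (4 * pi) * (fact (n - nat \<bar>m\<bar>) / fact (n + nat \<bar>m\<bar>))) *
       assoc_legendre n (nat \<bar>m\<bar>) (x $ 3)) *
     exp (\<i> * of_int m * of_real (Arg (Complex (x $ 1) (x $ 2))))"


section \<open>Spherical Bessel functions\<close>

text \<open>The Bessel and Neumann functions are only used for real \<open>x > 0\<close>; the formula for
  \<open>bessel_Y\<close> moreover requires the order \<open>\<nu>\<close> not to be an integer (below it is a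
  half-integer).\<close>

definition bessel_J :: "real \<Rightarrow> real \<Rightarrow> real" where
  "bessel_J \<nu> x =
     (\<Sum>p. (-1) ^ p * rGamma (real p + \<nu> + 1) / fact p * (x / 2) powr (2 * real p + \<nu>))"

definition bessel_Y :: "real \<Rightarrow> real \<Rightarrow> real" where
  "bessel_Y \<nu> x = (bessel_J \<nu> x * cos (\<nu> * pi) - bessel_J (- \<nu>) x) / sin (\<nu> * pi)"

definition sph_bessel_j :: "nat \<Rightarrow> real \<Rightarrow> real" where
  "sph_bessel_j n x = sqrt (pi / (2 * x)) * bessel_J (real n + 1 / 2) x"

definition sph_bessel_y :: "nat \<Rightarrow> real \<Rightarrow> real" where
  "sph_bessel_y n x = sqrt (pi / (2 * x)) * bessel_Y (real n + 1 / 2) x"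

definition sph_hankel_1 :: "nat \<Rightarrow> real \<Rightarrow> complex" where
  "sph_hankel_1 n x = of_real (sph_bessel_j n x) + \<i> * of_real (sph_bessel_y n x)"


section \<open>The constants\<close>

definition c_const :: "nat \<Rightarrow> real \<Rightarrow> complex" where
  "c_const n k = - (1 / 2) *
     integral {-1..1} (\<lambda>t. exp (\<i> * of_real (k * sqrt (2 * (1 - t)))) * of_real (poly (legendre_poly n) t))"

end

theory Submission
  imports Defs
begin

text \<open>On the unit sphere the kernel at \<open>(x, y)\<close> depends only on \<open>t = x \<bullet> y\<close>, through the chord length
  \<open>r = sqrt (2 (1 - t))\<close>: it is \<open>(1 - \<i> k r) exp (\<i> k r) / (8 \<pi> r)\<close>. By the Funk-Hecke formula \<open>Y\<close> is
  therefore an eigenfunction, with eigenvalue \<open>2 \<pi>\<close> times the integral of the kernel against \<open>P\<^sub>n\<close>.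

  The Funk-Hecke formula is obtained without rotation invariance of the surface measure. The spherical
  harmonics are the coefficients in \<open>w\<close> of \<open>(a \<bullet> y) ^ n\<close> for isotropic complex vectors \<open>a = a(w)\<close>. Averaging
  over the azimuth gives the moments \<open>\<integral> (\<xi> \<bullet> y) ^ M = 4 \<pi> / (M + 1) * (\<xi> \<bullet> \<xi>) ^ (M / 2)\<close> for complex \<open>\<xi>\<close>
  and even \<open>M\<close>; for \<open>\<xi> = x + \<tau> a\<close> one has \<open>\<xi> \<bullet> \<xi> = 1 + 2 \<tau> (x \<bullet> a)\<close>, and comparing powers of \<open>\<tau>\<close> gives the
  formula for monomial kernels. Weierstrass approximation and dominated convergence do the rest.

  The eigenvalue is computed by substituting \<open>t = 1 - r\<^sup>2 / 2\<close>, expanding \<open>exp (\<i> k r)\<close> in powers of \<open>k\<close>, and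
  comparing the moments \<open>\<integral> r ^ l * P\<^sub>n (1 - r\<^sup>2 / 2)\<close> over \<open>{0..2}\<close> with the Cauchy product of two Bessel
  series, which is summed by the Vandermonde identity.\<close>

section \<open>Moments of Legendre polynomials\<close>

text \<open>For \<open>a > 0\<close> this is the integral of
  \<open>u powr (a - 1) * poly p u\<close> over the unit interval. The sum stays meaningful for
  other \<open>a\<close> as long as no nonzero coefficient meets a zero denominator; repeated
  integration by parts lowers \<open>a\<close> below 0.\<close>

definition poly_moment :: "real \<Rightarrow> real poly \<Rightarrow> real" where
  "poly_moment a p = (\<Sum>i\<le>degree p. coeff p i / (a + real i))"

lemma poly_moment_bound:
  assumes "degree p \<le> N"
  shows "poly_moment a p = (\<Sum>i\<le>N. coeff p i / (a + real i))"
  unfolding poly_moment_def using assms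
  by (intro sum.mono_neutral_left) (auto intro: coeff_eq_0)

lemma poly_moment_diff: "poly_moment a (p - q) = poly_moment a p - poly_moment a q"
proof -
  let ?N = "max (degree p) (degree q)"
  show ?thesis
    using degree_diff_le_max[of p q]
    by (simp add: poly_moment_bound[of _ ?N] diff_divide_distrib sum_subtractf)
qed

lemma poly_moment_smult: "poly_moment a (smult c p) = c * poly_moment a p"
  by (simp add: poly_moment_bound[of _ "degree p"] sum_distrib_left)

lemma poly_moment_pCons_0: "poly_moment a (pCons 0 p) = poly_moment (a + 1) p"
proof -
  have "poly_moment a (pCons 0 p) = (\<Sum>i\<le>Suc (degree p). coeff (pCons 0 p) i / (a + real i))"
    by (rule poly_moment_bound) (simp add: degree_pCons_le)
  also have "\<dots> = (\<Sum>i\<le>degree p. coeff p i / (a + 1 + real i))"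
    by (subst sum.atMost_Suc_shift) (simp add: algebra_simps)
  finally show ?thesis by (simp add: poly_moment_def)
qed

lemma poly_moment_X_power: "poly_moment a ([:0, 1:] ^ n * p) = poly_moment (a + real n) p"
proof (induction n arbitrary: a)
  case (Suc n)
  have "[:0, 1:] ^ Suc n * p = pCons 0 ([:0, 1:] ^ n * p)"
    by (simp add: mult.assoc)
  then show ?case
    by (simp only: poly_moment_pCons_0 Suc.IH) (simp add: algebra_simps)
qed simp

text \<open>The Beta integral B(a, n + 1). The induction rests on (1 - u)^(n+1) = (1 - u)^n - u (1 -
  u)^n, where the factor u raises \<open>a\<close> by one.\<close>

lemma poly_moment_one_minus_power:
  "0 < a \<Longrightarrow> poly_moment a ([:1, -1:] ^ n) = fact n / pochhammer a (Suc n)"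
proof (induction n arbitrary: a)
  case 0
  then show ?case by (simp add: poly_moment_def)
next
  case (Suc n)
  have "[:1, -1:] ^ Suc n = [:1, -1::real:] ^ n - pCons 0 ([:1, -1:] ^ n)"
    by simp
  then have "poly_moment a ([:1, -1:] ^ Suc n)
      = fact n / pochhammer a (Suc n) - fact n / pochhammer (a + 1) (Suc n)"
    by (simp only: poly_moment_diff poly_moment_pCons_0) (use Suc in simp)
  moreover have "pochhammer a (Suc n) = pochhammer a (Suc (Suc n)) / (a + 1 + real n)"
    using Suc.prems by (subst pochhammer_rec'[of a "Suc n"]) (simp add: add_ac)
  moreover have "pochhammer (a + 1) (Suc n) = pochhammer a (Suc (Suc n)) / a"
    using Suc.prems by (simp add: pochhammer_rec[of a "Suc n"])
  moreover have "pochhammer a (Suc (Suc n)) > 0"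
    using Suc.prems by (rule pochhammer_pos)
  ultimately show ?case
    by (simp add: field_simps)
qed

text \<open>Integration by parts for \<open>\<integral> u powr (a - 1) * p' u\<close> over \<open>{0..1}\<close>.\<close>

lemma poly_moment_pderiv:
  assumes "poly p 1 = 0" and "coeff p 0 = 0"
    and nz: "\<And>i. coeff p i \<noteq> 0 \<Longrightarrow> a - 1 + real i \<noteq> 0"
  shows "poly_moment a (pderiv p) = (1 - a) * poly_moment (a - 1) p"
proof -
  \<comment> \<open>The boundary term at u = 1. It drops out once i / (a - 1 + i) is split as 1 + (1
    - a) / (a - 1 + i).\<close>
  have s0: "(\<Sum>i\<le>Suc (degree p). coeff p i) = 0"
    using assms(1) by (simp add: poly_altdef)
      (metis le_eq_less_or_eq coeff_eq_0 lessI)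
  have "poly_moment a (pderiv p) = (\<Sum>i\<le>degree p. coeff (pderiv p) i / (a + real i))"
    by (rule poly_moment_bound) (simp add: degree_pderiv)
  also have "\<dots> = (\<Sum>i\<le>Suc (degree p). real i * coeff p i / (a - 1 + real i))"
    by (subst sum.atMost_Suc_shift) (simp add: coeff_pderiv algebra_simps)
  also have "\<dots> = (\<Sum>i\<le>Suc (degree p). coeff p i + (1 - a) * (coeff p i / (a - 1 + real i)))"
  proof (rule sum.cong)
    fix i
    show "real i * coeff p i / (a - 1 + real i)
      = coeff p i + (1 - a) * (coeff p i / (a - 1 + real i))"
    proof (cases "coeff p i = 0")
      case False
      then show ?thesis using nz[OF False] by (simp add: field_simps)
    qed simp
  qed simp
  also have "\<dots> = (1 - a) * poly_moment (a - 1) p"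
    unfolding sum.distrib s0 sum_distrib_left[symmetric]
    by (subst poly_moment_bound[of p "Suc (degree p)"]) simp_all
  finally show ?thesis .
qed

lemma power_dvd_pderiv:
  fixes p q :: "'a::idom poly"
  assumes "q ^ Suc m dvd p"
  shows "q ^ m dvd pderiv p"
proof -
  obtain r where "p = q ^ Suc m * r" using assms by blast
  then have "pderiv p = q ^ m * (q * pderiv r + r * smult (of_nat (Suc m)) (pderiv q))"
    by (simp only: pderiv_mult pderiv_power_Suc) (simp add: algebra_simps)
  then show ?thesis by simp
qed

lemma power_dvd_higher_pderiv:
  fixes p q :: "'a::idom poly"
  assumes "q ^ n dvd p" and "j \<le> n"
  shows "q ^ (n - j) dvd (pderiv ^^ j) p"
  using assms(2)
proof (induction j)
  case (Suc j)
  then have "q ^ Suc (n - Suc j) dvd (pderiv ^^ j) p"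
    by (simp add: Suc_diff_Suc)
  from power_dvd_pderiv[OF this] show ?case by simp
qed (use assms in simp)

lemma higher_pderiv_pcompose_linear:
  fixes p :: "'a::idom poly"
  shows "(pderiv ^^ n) (pcompose p [:b, a:]) = smult (a ^ n) (pcompose ((pderiv ^^ n) p) [:b, a:])"
  by (induction n) (simp_all add: pderiv_smult pderiv_pcompose pderiv_pCons mult.commute)

lemma pcompose_power:
  fixes p q :: "'a::comm_semiring_1 poly"
  shows "pcompose (p ^ n) q = pcompose p q ^ n"
  using pcompose_prod[of "\<lambda>_. p" "{..<n}" q] by simp

text \<open>With t = 1 - 2 u, t^2 - 1 becomes -4 u (1 - u), and each derivative contributes a factor
  -2. What remains, (-4)^n / (-2)^n = 2^n, cancels against the 2^n of Rodrigues' formula.\<close>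

lemma legendre_poly_pcompose:
  "pcompose (legendre_poly n) [:1, -2:]
     = smult (1 / fact n) ((pderiv ^^ n) ([:0, 1:] ^ n * [:1, -1:] ^ n))"
proof -
  have "pcompose [:-1, 0, 1:] [:1, -2::real:] = smult (-4) ([:0, 1:] * [:1, -1:])"
    by (simp add: pcompose_pCons)
  then have "pcompose ([:-1, 0, 1:] ^ n) [:1, -2::real:] = smult ((-4) ^ n) ([:0, 1:] ^ n * [:1, -1:] ^ n)"
    by (simp only: pcompose_power smult_power power_mult_distrib)
  then have eq: "smult ((-4) ^ n) ((pderiv ^^ n) ([:0, 1:] ^ n * [:1, -1:] ^ n))
      = smult ((-2) ^ n) (pcompose ((pderiv ^^ n) ([:-1, 0, 1:] ^ n)) [:1, -2::real:])"
    using higher_pderiv_pcompose_linear[of n "[:-1, 0, 1:] ^ n" 1 "-2::real"]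
    by (simp only: higher_pderiv_smult)
  have "pcompose ((pderiv ^^ n) ([:-1, 0, 1:] ^ n)) [:1, -2::real:]
      = smult (1 / (-2) ^ n) (smult ((-2) ^ n) (pcompose ((pderiv ^^ n) ([:-1, 0, 1:] ^ n)) [:1, -2::real:]))"
    by simp
  also have "\<dots> = smult ((-4) ^ n / (-2) ^ n) ((pderiv ^^ n) ([:0, 1:] ^ n * [:1, -1:] ^ n))"
    unfolding eq[symmetric] by simp
  also have "(-4) ^ n / (-2) ^ n = (2::real) ^ n"
    by (simp flip: power_divide)
  finally have "pcompose ((pderiv ^^ n) ([:-1, 0, 1:] ^ n)) [:1, -2::real:]
      = smult (2 ^ n) ((pderiv ^^ n) ([:0, 1:] ^ n * [:1, -1:] ^ n))" .
  then show ?thesis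
    by (simp add: legendre_poly_def pcompose_smult)
qed

text \<open>Before each integration by parts the derivative at hand has order below n and so
  vanishes at 1. It contains only powers of u from n minus its order on, so the bound on
  \<open>a\<close> keeps the denominators of its nonzero coefficients positive.\<close>

lemma poly_moment_higher_pderiv:
  assumes "j \<le> n" and "a + real (n - j) > 0"
  shows "poly_moment a ((pderiv ^^ j) ([:0, 1:] ^ n * [:1, -1:] ^ n))
    = pochhammer (1 - a) j * poly_moment (a - real j) ([:0, 1:] ^ n * [:1, -1:] ^ n)"
  using assms
proof (induction j arbitrary: a)
  case (Suc j)
  define f :: "real poly" where "f = [:0, 1:] ^ n * [:1, -1:] ^ n"
  let ?g = "(pderiv ^^ j) f"
  have "[:1, -1:] ^ (n - j) dvd ?g"
    using Suc.prems by (intro power_dvd_higher_pderiv) (auto simp: f_def)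
  then have "[:1, -1:] dvd ?g"
    using Suc.prems by (metis dvd_power dvd_trans Suc_le_eq zero_less_diff)
  then have g1: "poly ?g 1 = 0"
    by (auto elim!: dvdE)
  have low: "coeff ?g i = 0" if "i < n - j" for i
  proof -
    have "coeff f (i + j) = 0"
      using that by (simp add: f_def coeff_monom_mult flip: monom_altdef[of 1 n, simplified])
    then show ?thesis by (simp add: coeff_higher_pderiv)
  qed
  have "poly_moment a (pderiv ?g) = (1 - a) * poly_moment (a - 1) ?g"
  proof (rule poly_moment_pderiv[OF g1])
    show "coeff ?g 0 = 0" using low[of 0] Suc.prems by simp
    fix i assume "coeff ?g i \<noteq> 0"
    then have "n - j \<le> i" using low by (meson not_le)
    then show "a - 1 + real i \<noteq> 0" using Suc.prems by (simp add: of_nat_diff)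
  qed
  also have "poly_moment (a - 1) ?g = pochhammer (1 - (a - 1)) j * poly_moment (a - 1 - real j) f"
    unfolding f_def using Suc.prems by (intro Suc.IH) (auto simp: of_nat_diff)
  finally show ?case
    by (simp add: f_def pochhammer_rec algebra_simps)
qed simp

text \<open>The factor u^n in Rodrigues' polynomial undoes the n steps by which \<open>a\<close> was
  lowered. A Beta integral at \<open>a\<close> itself remains, and its n! cancels the
  normalisation.\<close>

lemma legendre_poly_moment:
  assumes "0 < a"
  shows "poly_moment a (pcompose (legendre_poly n) [:1, -2:]) = pochhammer (1 - a) n / pochhammer a (Suc n)"
proof -
  have "poly_moment a (pcompose (legendre_poly n) [:1, -2:])
     = pochhammer (1 - a) n * poly_moment (a - real n) ([:0, 1:] ^ n * [:1, -1:] ^ n) / fact n"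
    using poly_moment_higher_pderiv[of n n a] assms
    by (simp add: legendre_poly_pcompose poly_moment_smult)
  then show ?thesis
    using assms by (simp add: poly_moment_X_power poly_moment_one_minus_power del: pochhammer_Suc)
qed

lemma has_integral_poly_moment:
  "((\<lambda>r. r ^ l * poly p (r\<^sup>2 / 4)) has_integral 2 ^ l * poly_moment ((real l + 1) / 2) p) {0..2}"
proof -
  have "((\<lambda>r. coeff p i / 4 ^ i * r ^ (2 * i + l)) has_integral
      2 ^ l * (coeff p i / ((real l + 1) / 2 + real i))) {0..2}" for i
  proof -
    have "((\<lambda>r::real. coeff p i / 4 ^ i * r ^ (2 * i + l)) has_integral
        coeff p i / 4 ^ i * 2 ^ Suc (2 * i + l) / real (Suc (2 * i + l))
        - coeff p i / 4 ^ i * 0 ^ Suc (2 * i + l) / real (Suc (2 * i + l))) {0..2}"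
      by (intro fundamental_theorem_of_calculus)
         (auto intro!: derivative_eq_intros simp del: power_Suc
           simp flip: has_real_derivative_iff_has_vector_derivative simp: nonzero_divide_eq_eq)
    moreover have "coeff p i / 4 ^ i * 2 ^ Suc (2 * i + l) / real (Suc (2 * i + l))
        - coeff p i / 4 ^ i * 0 ^ Suc (2 * i + l) / real (Suc (2 * i + l))
      = 2 ^ l * (coeff p i / ((real l + 1) / 2 + real i))"
      by (simp add: power_add power_mult divide_simps)
    ultimately show ?thesis by simp
  qed
  then have "((\<lambda>r. \<Sum>i\<le>degree p. coeff p i / 4 ^ i * r ^ (2 * i + l)) has_integral
      (\<Sum>i\<le>degree p. 2 ^ l * (coeff p i / ((real l + 1) / 2 + real i)))) {0..2}"
    by (intro has_integral_sum) auto
  moreover have "(\<Sum>i\<le>degree p. coeff p i / 4 ^ i * r ^ (2 * i + l)) = r ^ l * poly p (r\<^sup>2 / 4)" for r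
    by (simp add: poly_altdef sum_distrib_left power_add power_divide ac_simps flip: power_mult)
  ultimately show ?thesis by (simp add: poly_moment_def sum_distrib_left)
qed

text \<open>With u = r^2 / 4 the argument 1 - r^2 / 2 is 1 - 2 u, and r^l dr becomes 2^l u^(a-1) du
  for a = (l + 1) / 2.\<close>

lemma has_integral_legendre_power:
  "((\<lambda>r. r ^ l * poly (legendre_poly n) (1 - r\<^sup>2 / 2)) has_integral
     2 ^ l * pochhammer ((1 - real l) / 2) n / pochhammer ((real l + 1) / 2) (Suc n)) {0..2}"
  using has_integral_poly_moment[of l "pcompose (legendre_poly n) [:1, -2:]"]
    legendre_poly_moment[of "(real l + 1) / 2" n]
  by (simp add: poly_pcompose field_simps del: pochhammer_Suc)

section \<open>Products of Bessel functions\<close>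

lemma summable_bessel_J:
  fixes x \<nu> :: real
  assumes "0 < x"
  shows "summable (\<lambda>p. norm ((-1) ^ p * rGamma (real p + \<nu> + 1) / fact p * (x / 2) powr (2 * real p + \<nu>)))"
    (is "summable (\<lambda>p. norm (?a p))")
proof -
  \<comment> \<open>Beyond this index p + \<nu> + 1 is at least x^2. Since (p + 1) (p + \<nu> + 1)
    times the next term is -(x/2)^2 times the current one, the ratio is then at most 1/4 in absolute
    value.\<close>
  obtain N :: nat where N: "real N > \<bar>\<nu>\<bar> + x\<^sup>2"
    using reals_Archimedean2 by blast
  show ?thesis
  proof (rule summable_ratio_test)
    fix p assume p: "N \<le> p"
    then have *: "real p + \<nu> + 1 \<ge> x\<^sup>2" using N by linarith
    then have pos: "real p + \<nu> + 1 > 0" using assms by (smt (verit) zero_less_power)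
    have R: "rGamma (real p + \<nu> + 1) = (real p + \<nu> + 1) * rGamma (real (Suc p) + \<nu> + 1)"
      using rGamma_plus1[of "real p + \<nu> + 1"] by (simp add: add_ac)
    have "(x / 2) powr (2 * real (Suc p) + \<nu>) = (x / 2) powr 2 * (x / 2) powr (2 * real p + \<nu>)"
      by (simp add: algebra_simps flip: powr_add)
    then have E: "(x / 2) powr (2 * real (Suc p) + \<nu>) = (x / 2)\<^sup>2 * (x / 2) powr (2 * real p + \<nu>)"
      using assms by (simp add: powr_numeral)
    have a: "?a p * (x / 2)\<^sup>2 = - (real (Suc p) * (real p + \<nu> + 1)) * ?a (Suc p)"
      unfolding R E fact_Suc power_Suc by (simp add: divide_simps del: of_nat_Suc)
    have "\<bar>?a p\<bar> * (x / 2)\<^sup>2 = (real (Suc p) * (real p + \<nu> + 1)) * \<bar>?a (Suc p)\<bar>"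
      using arg_cong[OF a, of abs] pos unfolding abs_mult by simp
    moreover have "(real (Suc p) * (real p + \<nu> + 1)) * \<bar>?a (Suc p)\<bar> \<ge> (1 * x\<^sup>2) * \<bar>?a (Suc p)\<bar>"
      using * by (intro mult_right_mono mult_mono) auto
    ultimately have "\<bar>?a (Suc p)\<bar> * x\<^sup>2 \<le> (1 / 4 * \<bar>?a p\<bar>) * x\<^sup>2"
      by (simp only: power_divide) (simp add: mult_ac)
    then have "\<bar>?a (Suc p)\<bar> \<le> 1 / 4 * \<bar>?a p\<bar>"
      by (rule mult_right_le_imp_le) (use assms in simp)
    then show "norm (norm (?a (Suc p))) \<le> 1 / 4 * norm (norm (?a p))"
      by (simp only: real_norm_def abs_idempotent)
  qed simp
qed

text \<open>In the Cauchy product both reciprocal Gamma factors are moved to the index p. Each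
  Pochhammer symbol that arises, divided by the factorial from the other series, is a generalised
  binomial, and Vandermonde's identity sums the products. Since \<open>rGamma\<close> has no poles,
  negative orders need no separate treatment.\<close>

lemma bessel_J_mult_sums:
  fixes x \<mu> \<nu> :: real
  assumes "0 < x"
  shows "(\<lambda>p. (-1) ^ p * rGamma (real p + \<mu> + 1) * rGamma (real p + \<nu> + 1) *
      ((\<mu> + \<nu> + 2 * real p) gchoose p) * (x / 2) powr (2 * real p + \<mu> + \<nu>))
    sums (bessel_J \<mu> x * bessel_J \<nu> x)"
proof -
  let ?a = "\<lambda>\<nu> p. (-1) ^ p * rGamma (real p + \<nu> + 1) / fact p * (x / 2) powr (2 * real p + \<nu>)"
  have "(\<lambda>p. \<Sum>i\<le>p. ?a \<mu> i * ?a \<nu> (p - i)) sums (bessel_J \<mu> x * bessel_J \<nu> x)"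
    unfolding bessel_J_def by (intro Cauchy_product_sums summable_bessel_J assms)
  moreover have "(\<Sum>i\<le>p. ?a \<mu> i * ?a \<nu> (p - i)) = (-1) ^ p * rGamma (real p + \<mu> + 1) * rGamma (real p + \<nu> + 1) *
      ((\<mu> + \<nu> + 2 * real p) gchoose p) * (x / 2) powr (2 * real p + \<mu> + \<nu>)" for p
  proof -
    have "?a \<mu> i * ?a \<nu> (p - i) = (-1) ^ p * rGamma (real p + \<mu> + 1) * rGamma (real p + \<nu> + 1) *
       (x / 2) powr (2 * real p + \<mu> + \<nu>) * (((\<nu> + real p) gchoose i) * ((\<mu> + real p) gchoose (p - i)))"
      if "i \<le> p" for i
    proof -
      have "rGamma (real i + \<mu> + 1) = ((\<mu> + real p) gchoose (p - i)) * fact (p - i) * rGamma (real p + \<mu> + 1)"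
        using pochhammer_rGamma[of "real i + \<mu> + 1" "p - i"] that
        by (simp add: gbinomial_pochhammer' of_nat_diff algebra_simps)
      moreover have "rGamma (real (p - i) + \<nu> + 1) = ((\<nu> + real p) gchoose i) * fact i * rGamma (real p + \<nu> + 1)"
        using pochhammer_rGamma[of "real (p - i) + \<nu> + 1" i] that
        by (simp add: gbinomial_pochhammer' of_nat_diff algebra_simps)
      moreover have "(x / 2) powr (2 * real i + \<mu>) * (x / 2) powr (2 * real (p - i) + \<nu>)
          = (x / 2) powr (2 * real p + \<mu> + \<nu>)"
        using that by (simp add: of_nat_diff algebra_simps flip: powr_add)
      moreover have "(-1) ^ i * (-1) ^ (p - i) = (-1::real) ^ p"
        using that by (simp flip: power_add)
      ultimately show ?thesis
        by (simp add: field_simps)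
    qed
    then have "(\<Sum>i\<le>p. ?a \<mu> i * ?a \<nu> (p - i)) = (-1) ^ p * rGamma (real p + \<mu> + 1) * rGamma (real p + \<nu> + 1) *
       (x / 2) powr (2 * real p + \<mu> + \<nu>) * (\<Sum>i\<le>p. ((\<nu> + real p) gchoose i) * ((\<mu> + real p) gchoose (p - i)))"
      by (simp only: sum_distrib_left) (intro sum.cong, auto)
    then show ?thesis
      using gbinomial_Vandermonde[of "\<nu> + real p" "\<mu> + real p" p] by (simp add: atMost_atLeast0 algebra_simps)
  qed
  ultimately show ?thesis by simp
qed

section \<open>Legendre integrals of cos (k r) and sin (k r)\<close>

lemma rGamma_half_nat: "rGamma (real p + 1 / 2) = 4 ^ p * fact p / (fact (2 * p) * sqrt pi)"
proof (induction p)
  case 0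
  show ?case by (simp add: rGamma_inverse_Gamma Gamma_one_half_real field_simps)
next
  case (Suc p)
  have "rGamma (real (Suc p) + 1 / 2) = rGamma (real p + 1 / 2) / (real p + 1 / 2)"
    using rGamma_plus1[of "real p + 1 / 2"] by (simp add: field_simps)
  also have "\<dots> = 4 ^ p * fact p * 2 / (fact (2 * p) * (2 * real p + 1) * sqrt pi)"
    unfolding Suc.IH by (simp add: divide_simps)
  also have "\<dots> = 4 ^ p * fact p * 4 * real (Suc p) / (fact (2 * p) * (2 * real p + 1) * real (2 * Suc p) * sqrt pi)"
    by (simp add: divide_simps)
  finally show ?case by (simp add: mult_ac)
qed

text \<open>Termwise integration by the Weierstrass M-test: on \<open>{0..2}\<close> a term is at
  most \<open>\<bar>a p\<bar> * 2 ^ e p\<close> times a bound for the Legendre polynomial. The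
  exponents \<open>e\<close> are a parameter so that the cosine and the sine series are both
  instances.\<close>

lemma power_series_legendre_sums:
  fixes f :: "real \<Rightarrow> real"
  assumes sums: "\<And>r. r \<in> {0..2} \<Longrightarrow> (\<lambda>p. a p * r ^ e p) sums f r"
    and abs: "summable (\<lambda>p. \<bar>a p\<bar> * 2 ^ e p)"
  shows "(\<lambda>p. a p * (2 ^ e p * pochhammer ((1 - real (e p)) / 2) n / pochhammer ((real (e p) + 1) / 2) (Suc n)))
     sums integral {0..2} (\<lambda>r. f r * poly (legendre_poly n) (1 - r\<^sup>2 / 2))"
proof -
  let ?P = "\<lambda>r. poly (legendre_poly n) (1 - r\<^sup>2 / 2)"
  let ?I = "\<lambda>l. 2 ^ l * pochhammer ((1 - real l) / 2) n / pochhammer ((real l + 1) / 2) (Suc n)"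
  have "compact (?P ` {0..2})"
    by (intro compact_continuous_image continuous_intros) auto
  then obtain C where "\<forall>y \<in> ?P ` {0..2}. norm y \<le> C"
    using compact_imp_bounded bounded_iff by blast
  then have C: "\<bar>?P r\<bar> \<le> C" if "r \<in> {0..2}" for r
    using that by simp
  have "uniform_limit {0..2} (\<lambda>N r. \<Sum>p<N. a p * r ^ e p * ?P r) (\<lambda>r. \<Sum>p. a p * r ^ e p * ?P r) sequentially"
  proof (rule Weierstrass_m_test)
    fix p :: nat and r :: real assume r: "r \<in> {0..2}"
    have "\<bar>a p\<bar> * \<bar>r ^ e p\<bar> * \<bar>?P r\<bar> \<le> \<bar>a p\<bar> * 2 ^ e p * C"
      using r C[OF r] by (intro mult_mono) (auto intro: power_mono simp: power_abs)
    then show "norm (a p * r ^ e p * ?P r) \<le> \<bar>a p\<bar> * 2 ^ e p * C"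
      by (simp add: abs_mult)
  qed (intro summable_mult2 abs)
  then obtain I J where IJ: "\<And>N. ((\<lambda>r. \<Sum>p<N. a p * r ^ e p * ?P r) has_integral I N) {0..2}"
    "((\<lambda>r. \<Sum>p. a p * r ^ e p * ?P r) has_integral J) {0..2}" "I \<longlonglongrightarrow> J"
    by (rule uniform_limit_integral) (auto intro!: continuous_intros)
  then have "(\<lambda>N. integral {0..2} (\<lambda>r. \<Sum>p<N. a p * r ^ e p * ?P r)) \<longlonglongrightarrow>
     integral {0..2} (\<lambda>r. \<Sum>p. a p * r ^ e p * ?P r)"
    using integral_unique[OF IJ(1)] integral_unique[OF IJ(2)] by simp
  moreover have "((\<lambda>r. \<Sum>p<N. a p * r ^ e p * ?P r) has_integral (\<Sum>p<N. a p * ?I (e p))) {0..2}" for N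
  proof (rule has_integral_sum)
    fix p
    show "((\<lambda>r. a p * r ^ e p * ?P r) has_integral a p * ?I (e p)) {0..2}"
      using has_integral_mult_right[OF has_integral_legendre_power[of "e p" n], of "a p"]
      by (simp add: mult_ac)
  qed simp
  then have "integral {0..2} (\<lambda>r. \<Sum>p<N. a p * r ^ e p * ?P r) = (\<Sum>p<N. a p * ?I (e p))" for N
    by (rule integral_unique)
  moreover have "integral {0..2} (\<lambda>r. \<Sum>p. a p * r ^ e p * ?P r) = integral {0..2} (\<lambda>r. f r * ?P r)"
  proof (rule integral_cong)
    fix r :: real assume "r \<in> {0..2}"
    from sums_mult2[OF sums[OF this], of "?P r"]
    show "(\<Sum>p. a p * r ^ e p * ?P r) = f r * ?P r" by (rule sums_unique[symmetric])
  qed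
  ultimately show ?thesis by (simp add: sums_def)
qed

lemma summable_power_double_div_fact:
  fixes c :: real
  shows "summable (\<lambda>p. c ^ (2 * p) / fact (2 * p))"
proof (rule summable_comparison_test')
  show "summable (\<lambda>p. (c\<^sup>2) ^ p /\<^sub>R fact p)" by (rule summable_exp_generic)
  fix p :: nat
  have "fact p \<le> (fact (2 * p) :: real)" by (rule fact_mono) simp
  then show "norm (c ^ (2 * p) / fact (2 * p)) \<le> (c\<^sup>2) ^ p /\<^sub>R fact p"
    by (auto simp: power_mult power_divide divide_simps intro!: mult_left_mono)
qed

lemma integral_cos_legendre_sums:
  fixes k :: real
  shows "(\<lambda>p. (-1) ^ p * (2 * k) ^ (2 * p) / fact (2 * p) *
      (pochhammer (1 / 2 - real p) n / pochhammer (real p + 1 / 2) (Suc n)))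
    sums integral {0..2} (\<lambda>r. cos (k * r) * poly (legendre_poly n) (1 - r\<^sup>2 / 2))"
proof -
  have "(\<lambda>p. (-1) ^ p / fact (2 * p) * k ^ (2 * p) * r ^ (2 * p)) sums cos (k * r)" for r
    using cos_paired[of "k * r"] by (simp add: power_mult_distrib mult_ac)
  moreover have "summable (\<lambda>p. \<bar>(-1) ^ p / fact (2 * p) * k ^ (2 * p)\<bar> * 2 ^ (2 * p))"
    using summable_power_double_div_fact[of "2 * k"]
    by (simp add: abs_mult power_even_abs power_mult_distrib power_abs mult_ac)
  ultimately have "(\<lambda>p. (-1) ^ p / fact (2 * p) * k ^ (2 * p) * (2 ^ (2 * p) *
      pochhammer ((1 - real (2 * p)) / 2) n / pochhammer ((real (2 * p) + 1) / 2) (Suc n)))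
    sums integral {0..2} (\<lambda>r. cos (k * r) * poly (legendre_poly n) (1 - r\<^sup>2 / 2))"
    by (intro power_series_legendre_sums)
  moreover have "(1 - real (2 * p)) / 2 = 1 / 2 - real p" "(real (2 * p) + 1) / 2 = real p + 1 / 2" for p
    by simp_all
  ultimately show ?thesis
    by (simp only: power_mult_distrib) (simp only: mult_ac times_divide_eq_right times_divide_eq_left divide_divide_eq_left)
qed

lemma integral_sin_legendre_sums:
  fixes k :: real
  shows "(\<lambda>p. (-1) ^ p * (2 * k) ^ (2 * p + 1) / fact (2 * p + 1) *
      (pochhammer (- real p) n / pochhammer (real p + 1) (Suc n)))
    sums integral {0..2} (\<lambda>r. sin (k * r) * poly (legendre_poly n) (1 - r\<^sup>2 / 2))"
proof -
  have "(\<lambda>p. (-1) ^ p / fact (2 * p + 1) * k ^ (2 * p + 1) * r ^ (2 * p + 1)) sums sin (k * r)" for r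
    using sin_paired[of "k * r"] by (simp only: power_mult_distrib mult_ac)
  moreover have "summable (\<lambda>p. \<bar>(-1) ^ p / fact (2 * p + 1) * k ^ (2 * p + 1)\<bar> * 2 ^ (2 * p + 1))"
  proof (rule summable_comparison_test')
    show "summable (\<lambda>p. 2 * \<bar>k\<bar> * ((2 * k) ^ (2 * p) / fact (2 * p)))"
      by (intro summable_mult summable_power_double_div_fact)
    fix p :: nat
    have "\<bar>(-1) ^ p / fact (2 * p + 1) * k ^ (2 * p + 1)\<bar> * 2 ^ (2 * p + 1)
      = (2 * \<bar>k\<bar>) ^ (2 * p + 1) / fact (2 * p + 1)"
      by (simp add: abs_mult power_abs power_mult_distrib mult_ac)
    also have "\<dots> \<le> (2 * \<bar>k\<bar>) ^ (2 * p + 1) / fact (2 * p)"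
      by (intro divide_left_mono fact_mono) auto
    also have "\<dots> = 2 * \<bar>k\<bar> * ((2 * k) ^ (2 * p) / fact (2 * p))"
      by (simp add: power_mult_distrib power_even_abs)
    finally show "norm (\<bar>(-1) ^ p / fact (2 * p + 1) * k ^ (2 * p + 1)\<bar> * 2 ^ (2 * p + 1))
        \<le> 2 * \<bar>k\<bar> * ((2 * k) ^ (2 * p) / fact (2 * p))"
      by simp
  qed
  ultimately have "(\<lambda>p. (-1) ^ p / fact (2 * p + 1) * k ^ (2 * p + 1) * (2 ^ (2 * p + 1) *
      pochhammer ((1 - real (2 * p + 1)) / 2) n / pochhammer ((real (2 * p + 1) + 1) / 2) (Suc n)))
    sums integral {0..2} (\<lambda>r. sin (k * r) * poly (legendre_poly n) (1 - r\<^sup>2 / 2))"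
    by (intro power_series_legendre_sums)
  moreover have "(1 - real (2 * p + 1)) / 2 = - real p" "(real (2 * p + 1) + 1) / 2 = real p + 1" for p
    by simp_all
  ultimately show ?thesis
    by (simp only: power_mult_distrib) (simp only: mult_ac times_divide_eq_right times_divide_eq_left divide_divide_eq_left)
qed

text \<open>The two orders add up to 0, so the product of the Bessel series runs over even powers of
  k with the binomials (2p choose p). It agrees with the cosine series term by term.\<close>

lemma integral_cos_legendre_eq_bessel_J:
  fixes k :: real
  assumes "0 < k"
  shows "integral {0..2} (\<lambda>r. cos (k * r) * poly (legendre_poly n) (1 - r\<^sup>2 / 2))
    = (-1) ^ n * pi * (bessel_J (real n + 1 / 2) k * bessel_J (- (real n + 1 / 2)) k)"
proof -
  let ?\<nu> = "real n + 1 / 2"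
  have "(-1) ^ n * pi * ((-1) ^ p * rGamma (real p + ?\<nu> + 1) * rGamma (real p + - ?\<nu> + 1) *
      ((?\<nu> + - ?\<nu> + 2 * real p) gchoose p) * (k / 2) powr (2 * real p + ?\<nu> + - ?\<nu>))
    = (-1) ^ p * (2 * k) ^ (2 * p) / fact (2 * p) *
      (pochhammer (1 / 2 - real p) n / pochhammer (real p + 1 / 2) (Suc n))" for p
  proof -
    have pos: "pochhammer (real p + 1 / 2) (Suc n) > 0"
      by (intro pochhammer_pos) simp
    have 1: "rGamma (real p + ?\<nu> + 1) = rGamma (real p + 1 / 2) / pochhammer (real p + 1 / 2) (Suc n)"
      using pochhammer_rGamma[of "real p + 1 / 2" "Suc n"] pos
      by (simp add: field_simps del: pochhammer_Suc)
    \<comment> \<open>The sign (-1)^n arises here: the n factors of the Pochhammer symbol at p - n +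
      1/2 are the negatives of those at 1/2 - p, in reverse order.\<close>
    have 2: "rGamma (real p + - ?\<nu> + 1) = (-1) ^ n * pochhammer (1 / 2 - real p) n * rGamma (real p + 1 / 2)"
      using pochhammer_rGamma[of "real p + - ?\<nu> + 1" n] pochhammer_minus'[of "real p - 1 / 2" n]
      by (simp add: algebra_simps)
    have 3: "((?\<nu> + - ?\<nu> + 2 * real p) gchoose p) = fact (2 * p) / (fact p * fact p)"
      using binomial_fact[of p "2 * p", where ?'a = real]
      by (simp add: binomial_gbinomial)
    have 4: "(k / 2) powr (2 * real p + ?\<nu> + - ?\<nu>) = k ^ (2 * p) / 2 ^ (2 * p)"
      using powr_realpow[of "k / 2" "2 * p"] assms by (simp add: power_divide)
    have "(-1) ^ n * (-1) ^ n = (1::real)"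
      by (simp flip: power_mult_distrib)
    moreover have "(4::real) ^ p = 2 ^ (2 * p)" by (simp add: power_mult)
    ultimately show ?thesis
      unfolding 1 2 3 4 rGamma_half_nat using pos
      by (simp add: divide_simps power_mult_distrib real_sqrt_mult_self del: pochhammer_Suc)
  qed
  then have "(\<lambda>p. (-1) ^ p * (2 * k) ^ (2 * p) / fact (2 * p) *
      (pochhammer (1 / 2 - real p) n / pochhammer (real p + 1 / 2) (Suc n)))
     sums ((-1) ^ n * pi * (bessel_J ?\<nu> k * bessel_J (- ?\<nu>) k))"
    using sums_mult[OF bessel_J_mult_sums[OF assms, of ?\<nu> "- ?\<nu>"], of "(-1) ^ n * pi"] by simp
  with integral_cos_legendre_sums show ?thesis
    by (rule sums_unique2)
qed

text \<open>\<open>pochhammer (- real p) n\<close> vanishes for p < n, so the sine series starts at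
  p = n. After a shift by n it is the Cauchy square of the Bessel series.\<close>

lemma integral_sin_legendre_eq_bessel_J:
  fixes k :: real
  assumes "0 < k"
  shows "integral {0..2} (\<lambda>r. sin (k * r) * poly (legendre_poly n) (1 - r\<^sup>2 / 2))
    = pi * (bessel_J (real n + 1 / 2) k)\<^sup>2"
proof -
  let ?\<nu> = "real n + 1 / 2"
  let ?f = "\<lambda>p. (-1) ^ p * (2 * k) ^ (2 * p + 1) / fact (2 * p + 1) *
      (pochhammer (- real p) n / pochhammer (real p + 1) (Suc n))"
  have eq: "pi * ((-1) ^ p * rGamma (real p + ?\<nu> + 1) * rGamma (real p + ?\<nu> + 1) *
      ((?\<nu> + ?\<nu> + 2 * real p) gchoose p) * (k / 2) powr (2 * real p + ?\<nu> + ?\<nu>)) = ?f (p + n)" for p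
  proof -
    define q where "q = p + n"
    have 1: "rGamma (real p + ?\<nu> + 1) = 4 ^ Suc q * fact (Suc q) / (fact (2 * Suc q) * sqrt pi)"
      using rGamma_half_nat[of "Suc q"] by (simp add: q_def add_ac)
    also have "\<dots> = 4 ^ Suc q * fact q / (2 * fact (2 * q + 1) * sqrt pi)"
      by (simp add: divide_simps)
    also have "\<dots> = 2 ^ (2 * q + 1) * fact q / (fact (2 * q + 1) * sqrt pi)"
    proof -
      have "(2::real) ^ (2 * q + 1) = 2 * 4 ^ q" by (simp add: power_mult)
      show ?thesis unfolding \<open>(2::real) ^ (2 * q + 1) = 2 * 4 ^ q\<close> by (simp add: mult_ac)
    qed
    finally have 1: "rGamma (real p + ?\<nu> + 1) = 2 ^ (2 * q + 1) * fact q / (fact (2 * q + 1) * sqrt pi)" .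
    have "((?\<nu> + ?\<nu> + 2 * real p) gchoose p) = real ((2 * q + 1) choose p)"
      by (simp add: binomial_gbinomial q_def algebra_simps)
    also have "\<dots> = fact (2 * q + 1) / (fact p * fact (2 * q + 1 - p))"
      by (rule binomial_fact) (simp add: q_def)
    also have "2 * q + 1 - p = q + n + 1"
      by (simp add: q_def)
    finally have 3: "((?\<nu> + ?\<nu> + 2 * real p) gchoose p) = fact (2 * q + 1) / (fact p * fact (q + n + 1))" .
    have 4: "(k / 2) powr (2 * real p + ?\<nu> + ?\<nu>) = k ^ (2 * q + 1) / 2 ^ (2 * q + 1)"
      using powr_realpow[of "k / 2" "2 * q + 1"] assms by (simp add: power_divide q_def algebra_simps)
    have 5: "pochhammer (- real q) n = (-1) ^ n * (fact q / fact p)"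
      using pochhammer_minus[of "real q" n] pochhammer_product'[of "1::real" p n]
      by (simp add: q_def pochhammer_fact[symmetric] field_simps)
    have 6: "pochhammer (real q + 1) (Suc n) = fact (q + n + 1) / fact q"
      using pochhammer_product'[of "1::real" q "Suc n"]
      by (simp add: pochhammer_fact[symmetric] field_simps del: pochhammer_Suc fact_Suc)
    have "(-1) ^ q * (-1) ^ n = (-1::real) ^ p"
      by (simp add: q_def power_add flip: power_mult_distrib)
    then show ?thesis
      unfolding q_def[symmetric] 1 3 4 5 6
      by (simp add: divide_simps power_mult_distrib real_sqrt_mult_self del: fact_Suc power_Suc)
  qed
  have "(\<lambda>p. ?f (p + n)) sums (pi * (bessel_J ?\<nu> k)\<^sup>2)"
    unfolding eq[symmetric] power2_eq_square
    by (intro sums_mult bessel_J_mult_sums assms)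
  moreover have "?f p = 0" if "p < n" for p
    using that by (simp add: pochhammer_of_nat_eq_0_lemma)
  ultimately have "?f sums (pi * (bessel_J ?\<nu> k)\<^sup>2)"
    by (subst (asm) sums_zero_iff_shift) simp_all
  with integral_sin_legendre_sums show ?thesis
    by (rule sums_unique2)
qed

text \<open>At a half-integer order the cosine in \<open>bessel_Y\<close> vanishes and only the
  Bessel function of the opposite order survives.\<close>

lemma sph_bessel_y_eq:
  "sph_bessel_y n k = - ((-1) ^ n * sqrt (pi / (2 * k)) * bessel_J (- (real n + 1 / 2)) k)"
proof -
  have "cos ((real n + 1 / 2) * pi) = 0" "sin ((real n + 1 / 2) * pi) = (-1) ^ n"
    by (simp_all add: distrib_right cos_add sin_add)
  moreover have "x / (-1) ^ n = (-1) ^ n * x" for x :: real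
    by (cases "even n") auto
  ultimately show ?thesis
    by (simp add: sph_bessel_y_def bessel_Y_def)
qed

text \<open>2 i k j (j + i y) has real part -2 k j y and imaginary part 2 k j^2. These are the
  cosine and the sine integral, because the normalising factors of two spherical functions multiply
  to pi / (2 k).\<close>

lemma integral_exp_legendre_eq_hankel:
  fixes k :: real
  assumes "0 < k"
  shows "((\<lambda>r. exp (\<i> * of_real (k * r)) * of_real (poly (legendre_poly n) (1 - r\<^sup>2 / 2))) has_integral
     2 * \<i> * of_real k * (of_real (sph_bessel_j n k) * sph_hankel_1 n k)) {0..2}"
proof -
  let ?P = "\<lambda>r. poly (legendre_poly n) (1 - r\<^sup>2 / 2)"
  let ?s = "sqrt (pi / (2 * k))"
  have s: "?s * ?s = pi / (2 * k)"
    using assms by simp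
  have c: "((\<lambda>r. cos (k * r) * ?P r) has_integral - 2 * k * (sph_bessel_j n k * sph_bessel_y n k)) {0..2}"
  proof -
    have "- 2 * k * (sph_bessel_j n k * sph_bessel_y n k)
      = 2 * k * (?s * ?s) * (-1) ^ n * (bessel_J (real n + 1 / 2) k * bessel_J (- (real n + 1 / 2)) k)"
      unfolding sph_bessel_j_def sph_bessel_y_eq by (simp only: mult_ac mult_minus_left mult_minus_right minus_minus)
    also have "\<dots> = integral {0..2} (\<lambda>r. cos (k * r) * ?P r)"
      unfolding integral_cos_legendre_eq_bessel_J[OF assms] s using assms by simp
    finally show ?thesis
      by (simp only:) (auto intro!: integrable_integral integrable_continuous_interval continuous_intros)
  qed
  have d: "((\<lambda>r. sin (k * r) * ?P r) has_integral 2 * k * (sph_bessel_j n k * sph_bessel_j n k)) {0..2}"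
  proof -
    have "2 * k * (sph_bessel_j n k * sph_bessel_j n k)
      = 2 * k * (?s * ?s) * (bessel_J (real n + 1 / 2) k)\<^sup>2"
      unfolding sph_bessel_j_def power2_eq_square by (simp only: mult_ac)
    also have "\<dots> = integral {0..2} (\<lambda>r. sin (k * r) * ?P r)"
      unfolding integral_sin_legendre_eq_bessel_J[OF assms] s using assms by simp
    finally show ?thesis
      by (simp only:) (auto intro!: integrable_integral integrable_continuous_interval continuous_intros)
  qed
  have "((\<lambda>r. of_real (cos (k * r) * ?P r) + \<i> * of_real (sin (k * r) * ?P r)) has_integral
     of_real (- 2 * k * (sph_bessel_j n k * sph_bessel_y n k))
     + \<i> * of_real (2 * k * (sph_bessel_j n k * sph_bessel_j n k))) {0..2}"
    by (intro has_integral_add has_integral_mult_right has_integral_of_real c d)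
  moreover have "exp (\<i> * of_real (k * r)) * of_real (?P r)
      = of_real (cos (k * r) * ?P r) + \<i> * of_real (sin (k * r) * ?P r)" for r
    by (simp only: exp_Euler cos_of_real sin_of_real) (simp only: of_real_mult distrib_right mult.assoc)
  ultimately show ?thesis
    by (simp add: sph_hankel_1_def algebra_simps)
qed

section \<open>Central trinomial coefficients\<close>

text \<open>The coefficient of X^n in (a X^2 + c X + b)^n for any a, b with a b = d. It arises as
  the mean over a circle of the n-th power of a trigonometric polynomial of degree one.\<close>

definition central_trinomial :: "nat \<Rightarrow> 'a::comm_semiring_1 \<Rightarrow> 'a \<Rightarrow> 'a" where
  "central_trinomial n d c = (\<Sum>j\<le>n div 2. of_nat ((n choose (2 * j)) * ((2 * j) choose j)) * d ^ j * c ^ (n - 2 * j))"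

lemma coeff_binomial_X2_power:
  fixes a b :: "'a::comm_ring_1"
  shows "coeff ([:b, 0, a:] ^ k) k = (if even k then of_nat (k choose (k div 2)) * (a * b) ^ (k div 2) else 0)"
proof -
  have "[:b, 0, a:] = monom a 2 + [:b:]"
    by (simp add: monom_altdef numeral_2_eq_2)
  then have "coeff ([:b, 0, a:] ^ k) k = (\<Sum>i\<le>k. coeff (of_nat (k choose i) * monom a 2 ^ i * [:b:] ^ (k - i)) k)"
    by (simp only: binomial_ring coeff_sum)
  also have "\<dots> = (\<Sum>i\<le>k. if 2 * i = k then of_nat (k choose i) * a ^ i * b ^ (k - i) else 0)"
    by (intro sum.cong) (auto simp: monom_power pCons_one of_nat_poly poly_const_pow mult_ac)
  also have "\<dots> = (if even k then of_nat (k choose (k div 2)) * (a * b) ^ (k div 2) else 0)"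
  proof (cases "even k")
    case True
    then obtain j where j: "k = 2 * j" by blast
    have "(\<Sum>i\<le>k. if 2 * i = k then of_nat (k choose i) * a ^ i * b ^ (k - i) else 0)
       = (\<Sum>i\<le>k. if i = j then of_nat (k choose j) * a ^ j * b ^ (k - j) else 0)"
      by (intro sum.cong) (auto simp: j)
    then show ?thesis by (simp add: j power_mult_distrib mult_ac)
  next
    case False
    then show ?thesis by (auto intro!: sum.neutral)
  qed
  finally show ?thesis .
qed

text \<open>Take c X from n - k of the factors. The other k must supply X^k, so k is even, half of
  them giving a X^2 and half b.\<close>

lemma coeff_trinomial_power:
  fixes a b c :: "'a::comm_ring_1"
  shows "coeff ([:b, c, a:] ^ n) n = central_trinomial n (a * b) c"
proof -
  let ?g = "\<lambda>k. of_nat (n choose k) * c ^ (n - k) * coeff ([:b, 0, a:] ^ k) k"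
  have "[:b, c, a:] = [:b, 0, a:] + monom c 1"
    by (simp add: monom_altdef)
  then have "coeff ([:b, c, a:] ^ n) n = (\<Sum>k\<le>n. coeff (of_nat (n choose k) * [:b, 0, a:] ^ k * monom c 1 ^ (n - k)) n)"
    by (simp only: binomial_ring coeff_sum)
  also have "\<dots> = (\<Sum>k\<le>n. ?g k)"
  proof (rule sum.cong)
    fix k assume "k \<in> {..n}"
    moreover have "of_nat (n choose k) * [:b, 0, a:] ^ k * monom c 1 ^ (n - k)
        = monom (c ^ (n - k)) (n - k) * smult (of_nat (n choose k)) ([:b, 0, a:] ^ k)"
      by (simp add: monom_power of_nat_poly mult_ac)
    ultimately show "coeff (of_nat (n choose k) * [:b, 0, a:] ^ k * monom c 1 ^ (n - k)) n = ?g k"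
      by (simp add: coeff_monom_mult mult_ac)
  qed simp
  also have "\<dots> = (\<Sum>k \<in> (\<lambda>j. 2 * j) ` {..n div 2}. ?g k)"
  proof (rule sum.mono_neutral_right)
    show "\<forall>k \<in> {..n} - (\<lambda>j. 2 * j) ` {..n div 2}. ?g k = 0"
    proof
      fix k assume k: "k \<in> {..n} - (\<lambda>j. 2 * j) ` {..n div 2}"
      have "odd k"
      proof
        assume "even k"
        then have "k = 2 * (k div 2)" "k div 2 \<in> {..n div 2}" using k by (auto intro: div_le_mono)
        then show False using k by blast
      qed
      then show "?g k = 0" by (simp add: coeff_binomial_X2_power)
    qed
  qed auto
  also have "\<dots> = (\<Sum>j\<le>n div 2. ?g (2 * j))"
    by (subst sum.reindex) (auto simp: inj_on_def)
  finally show ?thesis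
    by (simp add: central_trinomial_def coeff_binomial_X2_power mult_ac)
qed

lemma central_trinomial_scale:
  fixes d c s :: "'a::comm_ring_1"
  shows "central_trinomial n (s\<^sup>2 * d) (s * c) = s ^ n * central_trinomial n d c"
proof -
  have "(s\<^sup>2 * d) ^ j * (s * c) ^ (n - 2 * j) = s ^ n * (d ^ j * c ^ (n - 2 * j))" if "j \<le> n div 2" for j
  proof -
    have "s ^ n = s ^ (2 * j) * s ^ (n - 2 * j)"
      using that by (simp flip: power_add)
    then show ?thesis
      by (simp only: power_mult_distrib power_mult) (simp only: mult_ac)
  qed
  then show ?thesis
    unfolding central_trinomial_def sum_distrib_left
    by (intro sum.cong) (auto simp: mult.assoc mult.left_commute)
qed

section \<open>Rodrigues' formula and spherical harmonics as coefficients\<close>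

lemma coeff_pcompose_reflected_shift:
  fixes p :: "real poly"
  shows "coeff (pcompose p [:z, -1:]) l = (-1) ^ l * poly ((pderiv ^^ l) p) z / fact l"
proof -
  have "fact l * coeff (pcompose p [:z, -1:]) l = coeff ((pderiv ^^ l) (pcompose p [:z, -1:])) 0"
    by (simp add: coeff_higher_pderiv pochhammer_fact)
  also have "\<dots> = (-1) ^ l * poly ((pderiv ^^ l) p) z"
    by (simp add: higher_pderiv_pcompose_linear poly_0_coeff_0[symmetric] poly_pcompose)
  finally show ?thesis by (simp add: field_simps)
qed

text \<open>Since 1 - (z - X)^2 = (1 - z^2) + 2 z X - X^2, the coefficients are, up to sign, the
  Taylor coefficients of (t^2 - 1)^n at z.\<close>

lemma coeff_rodrigues:
  fixes z :: real
  shows "coeff ([:1 - z\<^sup>2, 2 * z, -1:] ^ n) l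
    = (-1) ^ (n + l) * poly ((pderiv ^^ l) ([:-1, 0, 1:] ^ n)) z / fact l"
proof -
  have "[:1 - z\<^sup>2, 2 * z, -1:] = smult (-1) (pcompose [:-1, 0, 1:] [:z, -1:])"
    by (simp add: pcompose_pCons power2_eq_square)
  then have "[:1 - z\<^sup>2, 2 * z, -1:] ^ n = smult ((-1) ^ n) (pcompose ([:-1, 0, 1:] ^ n) [:z, -1:])"
    by (simp only: smult_power pcompose_power)
  then show ?thesis
    by (simp add: coeff_pcompose_reflected_shift power_add)
qed

text \<open>The case l = n of \<open>coeff_rodrigues\<close>, where the signs cancel; scaling by 2
  absorbs the 2^n of Rodrigues' formula. Together with \<open>has_integral_circle_power\<close> this
  amounts to Laplace's integral for P_n.\<close>

lemma legendre_poly_eq_central_trinomial: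
  "poly (legendre_poly n) t = central_trinomial n (- (1 - t\<^sup>2) / 4) t"
proof -
  have "2 ^ n * poly (legendre_poly n) t = coeff ([:1 - t\<^sup>2, 2 * t, -1:] ^ n) n"
    by (simp add: coeff_rodrigues legendre_poly_def flip: mult_2 power_mult)
  also have "\<dots> = central_trinomial n (2\<^sup>2 * (- (1 - t\<^sup>2) / 4)) (2 * t)"
  proof -
    have "2\<^sup>2 * (- (1 - t\<^sup>2) / 4) = -1 * (1 - t\<^sup>2)" by simp
    then show ?thesis by (simp only: coeff_trinomial_power)
  qed
  also have "\<dots> = 2 ^ n * central_trinomial n (- (1 - t\<^sup>2) / 4) t"
    by (rule central_trinomial_scale)
  finally show ?thesis by simp
qed

lemma of_real_central_trinomial:
  "of_real (central_trinomial n d c) = central_trinomial n (of_real d) (of_real c :: complex)"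
  by (simp add: central_trinomial_def)

lemma coeff_of_real_power:
  fixes a b c :: real
  shows "coeff ([:of_real a, of_real b, of_real c:] ^ n) l = (of_real (coeff ([:a, b, c:] ^ n) l) :: complex)"
proof (induction n arbitrary: l)
  case 0
  then show ?case by (cases l) auto
next
  case (Suc n)
  then show ?case by (simp add: coeff_pCons')
qed

text \<open>Putting \<open>cnj \<xi>\<close> X for X in the real quadratic gives
  \<open>cnj \<xi>\<close> times the complex one, because \<xi> times its conjugate is 1 - z^2. At
  the coefficient n + j a surplus \<open>cnj \<xi> ^ j\<close> remains, which carries the dependence
  on the azimuth.\<close>

lemma coeff_null_power:
  fixes \<xi> :: complex and z :: real
  assumes "(cmod \<xi>)\<^sup>2 = 1 - z\<^sup>2"
  shows "coeff ([:\<xi>, of_real (2 * z), - cnj \<xi>:] ^ n) (n + j)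
    = cnj \<xi> ^ j * of_real (coeff ([:1 - z\<^sup>2, 2 * z, -1:] ^ n) (n + j))"
proof -
  let ?P = "[:of_real (1 - z\<^sup>2), of_real (2 * z), of_real (-1) :: complex:]"
  let ?Q = "[:\<xi>, of_real (2 * z), - cnj \<xi>:]"
  have "coeff (?Q ^ n) (n + j) = cnj \<xi> ^ j * coeff (?P ^ n) (n + j)"
  proof (cases "\<xi> = 0")
    case False
    have "\<xi> * cnj \<xi> = of_real (1 - z\<^sup>2)"
      using assms by (metis complex_norm_square)
    then have "pcompose ?P [:0, cnj \<xi>:] = smult (cnj \<xi>) ?Q"
      by (simp add: pcompose_pCons mult_ac)
    then have "pcompose (?P ^ n) [:0, cnj \<xi>:] = smult (cnj \<xi> ^ n) (?Q ^ n)"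
      by (simp only: smult_power pcompose_power)
    from arg_cong[OF this, of "\<lambda>p. coeff p (n + j)"]
    have "cnj \<xi> ^ (n + j) * coeff (?P ^ n) (n + j) = cnj \<xi> ^ n * coeff (?Q ^ n) (n + j)"
      by (simp only: coeff_pcompose_linear coeff_smult)
    then show ?thesis using False by (simp add: power_add)
  next
    \<comment> \<open>At the poles nothing can be cancelled, but both quadratics are divisible by X
      and the coefficients can be read off. For j > 0 both sides are 0.\<close>
    case True
    then have "1 - z\<^sup>2 = 0"
      using assms by simp
    then have z: "(of_real z)\<^sup>2 = (1::complex)"
      by (simp flip: of_real_power)
    have "?Q ^ n = monom (of_real (2 * z) ^ n) n"
      by (simp add: True monom_power monom_altdef[of _ 1, simplified, symmetric])
    moreover have "?P ^ n = monom 1 n * [:of_real (2 * z), -1:] ^ n"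
    proof -
      have "?P = monom 1 1 * [:of_real (2 * z), -1:]"
        by (simp add: z monom_altdef)
      then show ?thesis by (simp only: power_mult_distrib monom_power) simp
    qed
    ultimately show ?thesis
      using True by (cases j) (simp_all add: coeff_monom_mult coeff_0_power)
  qed
  then show ?thesis
    by (simp only: coeff_of_real_power)
qed

text \<open>As a polynomial in w the quadratic is (1 - w^2) y1 + i (1 + w^2) y2 + 2 w y3, an
  isotropic linear form in y. The coefficient n + j of its n-th power contains the derivative of
  order n + j in Rodrigues' formula, and \<open>cnj \<xi> ^ j\<close> supplies both the square root
  factor of \<open>assoc_legendre\<close> and the phase of order -j.\<close>

lemma sph_harmonic_eq_coeff:
  fixes y :: "real^3"
  assumes "y \<in> sphere 0 1" and "j \<le> n"
  shows "sph_harmonic n (- int j) y =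
     of_real (sqrt ((2 * real n + 1) / (4 * pi) * (fact (n - j) / fact (n + j))) *
       ((-1) ^ j * fact (n + j) / (2 ^ n * fact n))) *
     coeff ([:Complex (y $ 1) (y $ 2), of_real (2 * y $ 3), - cnj (Complex (y $ 1) (y $ 2)):] ^ n) (n + j)"
proof -
  let ?\<xi> = "Complex (y $ 1) (y $ 2)" and ?z = "y $ 3"
  have "(norm y)\<^sup>2 = (y $ 1)\<^sup>2 + (y $ 2)\<^sup>2 + (y $ 3)\<^sup>2"
    by (simp add: norm_vec_def L2_set_def sum_3 real_sqrt_pow2_iff)
  then have norm: "(cmod ?\<xi>)\<^sup>2 = 1 - ?z\<^sup>2"
    using assms(1) by (simp add: cmod_power2)
  have "cnj ?\<xi> = of_real (cmod ?\<xi>) * cis (- Arg ?\<xi>)"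
    by (metis cis_cnj complex_cnj_complex_of_real complex_cnj_mult rcis_cmod_Arg rcis_def)
  moreover have "cmod ?\<xi> = sqrt (1 - ?z\<^sup>2)"
    by (metis norm norm_ge_zero real_sqrt_abs abs_of_nonneg)
  ultimately have cnj: "cnj ?\<xi> ^ j = of_real (sqrt (1 - ?z\<^sup>2) ^ j) * exp (\<i> * of_int (- int j) * of_real (Arg ?\<xi>))"
    by (simp only: power_mult_distrib Complex.DeMoivre of_real_power) (simp add: cis_conv_exp mult_ac)
  have "(pderiv ^^ j) (legendre_poly n) = smult (1 / (2 ^ n * fact n)) ((pderiv ^^ (n + j)) ([:-1, 0, 1:] ^ n))"
    by (simp add: legendre_poly_def higher_pderiv_smult funpow_add[symmetric] add.commute flip: o_apply[of "pderiv ^^ j"])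
  then have "assoc_legendre n j ?z = sqrt (1 - ?z\<^sup>2) ^ j *
      ((-1) ^ j * fact (n + j) / (2 ^ n * fact n) * coeff ([:1 - ?z\<^sup>2, 2 * ?z, -1:] ^ n) (n + j))"
    by (simp add: assoc_legendre_def coeff_rodrigues power_add field_simps flip: power_mult_distrib)
  then show ?thesis
    unfolding coeff_null_power[OF norm] cnj sph_harmonic_def
    by simp
qed

section \<open>Integrals of trigonometric polynomials over a circle\<close>

lemma has_integral_cis:
  "((\<lambda>\<phi>. cis (of_int m * \<phi>)) has_integral (if m = 0 then of_real (2 * pi) else 0)) {0..2 * pi}"
proof (cases "m = 0")
  case True
  then show ?thesis using has_integral_const_real[of "1::complex" 0 "2 * pi"] by (simp add: scaleR_conv_of_real)
next
  case False
  have "((\<lambda>\<phi>. cis (of_int m * \<phi>)) has_integral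
      cis (of_int m * (2 * pi)) / (\<i> * of_int m) - cis (of_int m * 0) / (\<i> * of_int m)) {0..2 * pi}"
  proof (rule fundamental_theorem_of_calculus)
    fix x :: real
    have "((\<lambda>w. exp (\<i> * of_int m * w) / (\<i> * of_int m)) has_field_derivative exp (\<i> * of_int m * of_real x))
       (at (of_real x))"
      using False by (auto intro!: derivative_eq_intros)
    from has_vector_derivative_real_field[OF this]
    show "((\<lambda>\<phi>. cis (of_int m * \<phi>) / (\<i> * of_int m)) has_vector_derivative cis (of_int m * x))
        (at x within {0..2 * pi})"
      by (simp add: cis_conv_exp mult_ac)
  qed simp
  moreover have "cis (of_int m * (2 * pi)) = 1"
    using cis_multiple_2pi[of "of_int m"] by (simp add: mult_ac)
  ultimately show ?thesis using False by simp
qed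

lemma has_integral_poly_cis:
  "((\<lambda>\<phi>. cis (- (real M * \<phi>)) * poly p (cis \<phi>)) has_integral of_real (2 * pi) * coeff p M) {0..2 * pi}"
proof -
  have "((\<lambda>\<phi>. \<Sum>i\<le>max M (degree p). coeff p i * cis (of_int (int i - int M) * \<phi>)) has_integral
      (\<Sum>i\<le>max M (degree p). coeff p i * (if int i - int M = 0 then of_real (2 * pi) else 0))) {0..2 * pi}"
    by (intro has_integral_sum has_integral_mult_right has_integral_cis) auto
  moreover have "(\<Sum>i\<le>max M (degree p). coeff p i * (if int i - int M = 0 then of_real (2 * pi) else 0))
     = of_real (2 * pi) * coeff p M"
    by (simp add: if_distrib[of "(*) _"] mult_ac cong: if_cong)
  moreover have "(\<Sum>i\<le>max M (degree p). coeff p i * cis (of_int (int i - int M) * \<phi>))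
     = cis (- (real M * \<phi>)) * poly p (cis \<phi>)" for \<phi>
  proof -
    have "poly p (cis \<phi>) = (\<Sum>i\<le>max M (degree p). coeff p i * cis \<phi> ^ i)"
      unfolding poly_altdef by (intro sum.mono_neutral_left) (auto intro: coeff_eq_0)
    then show ?thesis
      by (simp add: sum_distrib_left Complex.DeMoivre cis_mult algebra_simps)
  qed
  ultimately show ?thesis by simp
qed

text \<open>By Euler's formulas the base is cis (-\<phi>) times a quadratic polynomial in cis
  \<phi>. Integration over a period picks the middle coefficient of its M-th power, and its outer
  coefficients multiply to (\<alpha>^2 + \<beta>^2) / 4.\<close>

lemma has_integral_circle_power:
  fixes \<alpha> \<beta> \<delta> :: complex
  shows "((\<lambda>\<phi>. (\<alpha> * of_real (cos \<phi>) + \<beta> * of_real (sin \<phi>) + \<delta>) ^ M) has_integral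
     of_real (2 * pi) * central_trinomial M ((\<alpha>\<^sup>2 + \<beta>\<^sup>2) / 4) \<delta>) {0..2 * pi}"
proof -
  let ?p = "[:(\<alpha> + \<i> * \<beta>) / 2, \<delta>, (\<alpha> - \<i> * \<beta>) / 2:]"
  have "\<alpha> * of_real (cos \<phi>) + \<beta> * of_real (sin \<phi>) + \<delta> = cis (- \<phi>) * poly ?p (cis \<phi>)" for \<phi>
  proof -
    have c: "cis (- \<phi>) * cis \<phi> = 1" by (simp add: cis_mult)
    have "cis (- \<phi>) * poly ?p (cis \<phi>) = cis (- \<phi>) * ((\<alpha> + \<i> * \<beta>) / 2) + (cis (- \<phi>) * cis \<phi>) * \<delta>
        + (cis (- \<phi>) * cis \<phi>) * cis \<phi> * ((\<alpha> - \<i> * \<beta>) / 2)"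
      by (simp add: algebra_simps)
    also have "\<dots> = cis (- \<phi>) * ((\<alpha> + \<i> * \<beta>) / 2) + \<delta> + cis \<phi> * ((\<alpha> - \<i> * \<beta>) / 2)"
      unfolding c by simp
    also have "\<dots> = \<alpha> * of_real (cos \<phi>) + \<beta> * of_real (sin \<phi>) + \<delta>"
      by (simp add: complex_eq_iff field_simps)
    finally show ?thesis by simp
  qed
  then have "(\<alpha> * of_real (cos \<phi>) + \<beta> * of_real (sin \<phi>) + \<delta>) ^ M = cis (- (real M * \<phi>)) * poly (?p ^ M) (cis \<phi>)" for \<phi>
    by (simp only: power_mult_distrib Complex.DeMoivre poly_power mult_minus_right)
  moreover have "coeff (?p ^ M) M = central_trinomial M ((\<alpha>\<^sup>2 + \<beta>\<^sup>2) / 4) \<delta>"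
    by (simp add: coeff_trinomial_power algebra_simps power2_eq_square)
  ultimately show ?thesis
    using has_integral_poly_cis[of M "?p ^ M"] by (simp only:)
qed

section \<open>Moments of linear forms on the sphere\<close>

lemma spherical_coords_component:
  "spherical_coords (\<theta>, \<phi>) $ 1 = sin \<theta> * cos \<phi>"
  "spherical_coords (\<theta>, \<phi>) $ 2 = sin \<theta> * sin \<phi>"
  "spherical_coords (\<theta>, \<phi>) $ 3 = cos \<theta>"
  by (simp_all add: spherical_coords_def)

lemma continuous_on_spherical_coords: "continuous_on A spherical_coords"
proof -
  have eq: "spherical_coords = (\<lambda>p. \<chi> i. if i = 1 then sin (fst p) * cos (snd p)
      else if i = 2 then sin (fst p) * sin (snd p) else cos (fst p))"
    by (rule ext) (auto simp: vec_eq_iff forall_3 spherical_coords_component split: prod.splits)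
  have "continuous_on A (\<lambda>p. if i = 1 then sin (fst p) * cos (snd p)
      else if i = 2 then sin (fst p) * sin (snd p) else cos (fst p))" for i :: 3
    by (cases "i = 1"; cases "i = 2") (auto intro!: continuous_intros)
  then show ?thesis
    unfolding eq by (rule continuous_on_vec_lambda)
qed

lemma borel_measurable_spherical_coords [measurable]: "spherical_coords \<in> borel_measurable borel"
  by (intro borel_measurable_continuous_onI continuous_on_spherical_coords)

lemma norm_spherical_coords: "norm (spherical_coords p) = 1"
proof -
  obtain \<theta> \<phi> where p: "p = (\<theta>, \<phi>)" by fastforce
  have "(sin \<theta> * cos \<phi>)\<^sup>2 + (sin \<theta> * sin \<phi>)\<^sup>2 + (cos \<theta>)\<^sup>2 = (sin \<theta>)\<^sup>2 * ((cos \<phi>)\<^sup>2 + (sin \<phi>)\<^sup>2) + (cos \<theta>)\<^sup>2"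
    by (simp only: power_mult_distrib distrib_left)
  then show ?thesis
    by (simp add: p norm_vec_def L2_set_def sum_3 spherical_coords_component)
qed

text \<open>A single real weight under \<open>ennreal\<close> is the shape that the rules for
  densities ask for; it is nonnegative because the sine is so on \<open>{0..pi}\<close>.\<close>

lemma sphere_measure_eq_density:
  "sphere_measure = distr (density lborel (\<lambda>p. ennreal (indicator (cbox (0, 0) (pi, 2 * pi)) p * sin (fst p)))) borel spherical_coords"
proof -
  have "(\<lambda>(\<theta>, \<phi>). indicator ({0..pi} \<times> {0..2 * pi}) (\<theta>, \<phi>) * ennreal (sin \<theta>))
     = (\<lambda>p. ennreal (indicator (cbox (0, 0) (pi, 2 * pi)) p * sin (fst p)))"
    by (rule ext) (auto simp: indicator_def split: prod.splits)
  then show ?thesis by (simp add: sphere_measure_def)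
qed

lemma sets_sphere_measure [measurable_cong, simp]: "sets sphere_measure = sets borel"
  by (simp add: sphere_measure_def)

lemma AE_sphere_measure: "AE y in sphere_measure. norm y = 1"
  unfolding sphere_measure_eq_density
  by (subst AE_distr_iff) (auto simp: norm_spherical_coords)

text \<open>Continuity on the whole space gives Borel measurability. Continuity of the pulled-back
  integrand on the compact parameter box turns the Lebesgue integral into iterated gauge
  integrals.\<close>

lemma continuous_sphere_measure:
  fixes f :: "real^3 \<Rightarrow> 'b::euclidean_space"
  assumes "continuous_on UNIV f"
  shows integrable_sphere_measure: "integrable sphere_measure f"
    and integral_sphere_measure: "(LINT y|sphere_measure. f y) =
      integral {0..pi} (\<lambda>\<theta>. integral {0..2 * pi} (\<lambda>\<phi>. sin \<theta> *\<^sub>R f (spherical_coords (\<theta>, \<phi>))))"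
proof -
  let ?C = "cbox (0, 0) (pi, 2 * pi) :: (real \<times> real) set"
  let ?F = "\<lambda>p. sin (fst p) *\<^sub>R f (spherical_coords p)"
  let ?w = "\<lambda>p. indicator ?C p * sin (fst p)"
  have meas [measurable]: "f \<in> borel_measurable borel"
    using assms by (rule borel_measurable_continuous_onI)
  have w: "AE p in lborel. 0 \<le> ?w p"
    by (auto simp: indicator_def sin_ge_zero)
  have cont: "continuous_on ?C ?F"
    by (intro continuous_intros continuous_on_compose2[OF assms] continuous_on_spherical_coords) auto
  have eq: "?w p *\<^sub>R f (spherical_coords p) = indicator ?C p *\<^sub>R ?F p" for p
    by (simp add: indicator_def)
  have int: "integrable lborel (\<lambda>p. indicator ?C p *\<^sub>R ?F p)"
    by (intro borel_integrable_compact compact_cbox cont)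
  have wm: "?w \<in> borel_measurable lborel"
  proof -
    have "indicat_real ?C \<in> borel_measurable borel"
      by (intro borel_measurable_indicator) simp
    moreover have "(\<lambda>p::real \<times> real. sin (fst p)) \<in> borel_measurable borel"
      by (intro borel_measurable_continuous_onI continuous_intros)
    ultimately show ?thesis
      by (simp add: borel_measurable_times)
  qed
  have fm: "(\<lambda>p. f (spherical_coords p)) \<in> borel_measurable lborel"
    by measurable
  have sc: "spherical_coords \<in> measurable (density lborel (\<lambda>p. ennreal (?w p))) borel"
    by simp
  show "integrable sphere_measure f"
    unfolding sphere_measure_eq_density integrable_distr_eq[OF sc meas]
      integrable_density[OF fm wm w] eq by (rule int)
  have "(LINT y|sphere_measure. f y) = (LINT p|lborel. ?w p *\<^sub>R f (spherical_coords p))"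
    unfolding sphere_measure_eq_density integral_distr[OF sc meas]
      integral_density[OF fm wm w] ..
  also have "\<dots> = (LINT p:?C|lborel. ?F p)"
    by (simp only: eq set_lebesgue_integral_def)
  also have "\<dots> = integral ?C ?F"
    using int by (intro set_borel_integral_eq_integral) (simp add: set_integrable_def)
  also have "\<dots> = integral (cbox 0 pi) (\<lambda>\<theta>. integral (cbox 0 (2 * pi)) (\<lambda>\<phi>. ?F (\<theta>, \<phi>)))"
    by (rule integral_prod_continuous[OF cont])
  finally show "(LINT y|sphere_measure. f y) =
      integral {0..pi} (\<lambda>\<theta>. integral {0..2 * pi} (\<lambda>\<phi>. sin \<theta> *\<^sub>R f (spherical_coords (\<theta>, \<phi>))))"
    by simp
qed

definition linear_form :: "complex \<Rightarrow> complex \<Rightarrow> complex \<Rightarrow> real^3 \<Rightarrow> complex" where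
  "linear_form a b c y = a * of_real (y $ 1) + b * of_real (y $ 2) + c * of_real (y $ 3)"

lemma continuous_on_linear_form [continuous_intros]: "continuous_on A (linear_form a b c)"
  unfolding linear_form_def by (intro continuous_intros)

text \<open>The third coordinate is constant on each parallel, so the azimuthal integral is one of
  \<open>has_integral_circle_power\<close>; the substitution t = cos \<theta> then absorbs the
  weight sin \<theta>.\<close>

lemma integral_polar_power_linear_form:
  "(LINT y|sphere_measure. of_real (y $ 3) ^ N * linear_form a b c y ^ M) =
     of_real (2 * pi) * integral {-1..1} (\<lambda>t. of_real t ^ N * central_trinomial M ((a\<^sup>2 + b\<^sup>2) / 4 * of_real (1 - t\<^sup>2)) (c * of_real t))"
proof -
  let ?G = "\<lambda>t::real. of_real t ^ N * central_trinomial M ((a\<^sup>2 + b\<^sup>2) / 4 * of_real (1 - t\<^sup>2)) (c * of_real t)"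
  have "integral {0..2 * pi} (\<lambda>\<phi>. sin \<theta> *\<^sub>R (of_real (spherical_coords (\<theta>, \<phi>) $ 3) ^ N * linear_form a b c (spherical_coords (\<theta>, \<phi>)) ^ M))
     = of_real (2 * pi) * (sin \<theta> *\<^sub>R ?G (cos \<theta>))" for \<theta>
  proof (rule integral_unique)
    have eq: "of_real (2 * pi) * (sin \<theta> *\<^sub>R ?G (cos \<theta>)) = of_real (sin \<theta>) * of_real (cos \<theta>) ^ N *
        (of_real (2 * pi) * central_trinomial M (((a * of_real (sin \<theta>))\<^sup>2 + (b * of_real (sin \<theta>))\<^sup>2) / 4) (c * of_real (cos \<theta>)))"
    proof -
      have "(a\<^sup>2 + b\<^sup>2) / 4 * of_real (1 - (cos \<theta>)\<^sup>2) = ((a * of_real (sin \<theta>))\<^sup>2 + (b * of_real (sin \<theta>))\<^sup>2) / 4"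
        unfolding sin_squared_eq[symmetric] by (simp add: power_mult_distrib algebra_simps)
      then show ?thesis by (simp only: scaleR_conv_of_real mult_ac)
    qed
    have eq2: "sin \<theta> *\<^sub>R (of_real (spherical_coords (\<theta>, \<phi>) $ 3) ^ N * linear_form a b c (spherical_coords (\<theta>, \<phi>)) ^ M)
       = of_real (sin \<theta>) * of_real (cos \<theta>) ^ N *
         (a * of_real (sin \<theta>) * of_real (cos \<phi>) + b * of_real (sin \<theta>) * of_real (sin \<phi>) + c * of_real (cos \<theta>)) ^ M" for \<phi>
      by (simp only: linear_form_def spherical_coords_component scaleR_conv_of_real of_real_mult mult.assoc)
    show "((\<lambda>\<phi>. sin \<theta> *\<^sub>R (of_real (spherical_coords (\<theta>, \<phi>) $ 3) ^ N * linear_form a b c (spherical_coords (\<theta>, \<phi>)) ^ M))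
        has_integral of_real (2 * pi) * (sin \<theta> *\<^sub>R ?G (cos \<theta>))) {0..2 * pi}"
      unfolding eq eq2 by (intro has_integral_mult_right has_integral_circle_power)
  qed
  moreover have "continuous_on UNIV (\<lambda>y::real^3. of_real (y $ 3) ^ N * linear_form a b c y ^ M)"
    by (intro continuous_intros)
  ultimately have "(LINT y|sphere_measure. of_real (y $ 3) ^ N * linear_form a b c y ^ M)
     = integral {0..pi} (\<lambda>\<theta>. of_real (2 * pi) * (sin \<theta> *\<^sub>R ?G (cos \<theta>)))"
    by (simp only: integral_sphere_measure)
  also have "\<dots> = of_real (2 * pi) * integral {0..pi} (\<lambda>\<theta>. sin \<theta> *\<^sub>R ?G (cos \<theta>))"
    by (rule integral_mult_right)
  also have "integral {0..pi} (\<lambda>\<theta>. sin \<theta> *\<^sub>R ?G (cos \<theta>)) = integral {-1..1} ?G"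
  proof -
    \<comment> \<open>The substitution rule covers both orientations. As cos 0 exceeds cos pi, the
      first of the two integrals is over an empty interval.\<close>
    have "((\<lambda>\<theta>. - sin \<theta> *\<^sub>R ?G (cos \<theta>)) has_integral integral {cos 0..cos pi} ?G - integral {cos pi..cos 0} ?G) {0..pi}"
    proof (rule has_integral_substitution_general[where s = "{}" and c = "-1" and d = 1])
      show "continuous_on {-1..1} ?G"
        unfolding central_trinomial_def by (intro continuous_intros)
    qed (auto intro!: continuous_intros derivative_eq_intros)
    from has_integral_neg[OF this] show ?thesis by (intro integral_unique) simp
  qed
  finally show ?thesis .
qed

text \<open>A Beta integral. The function (1 - t^2)^(j+1) t^(2q+1) vanishes at both ends, and its
  derivative relates j + 1 at q to j at q + 1; hence \<open>q\<close> is arbitrary in the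
  induction.\<close>

lemma has_integral_even_monomial:
  "((\<lambda>t::real. (1 - t\<^sup>2) ^ j * t ^ (2 * q)) has_integral
     2 * 4 ^ j * fact j * fact (j + q) * fact (2 * q) / (fact q * fact (2 * (j + q) + 1))) {-1..1}"
proof (induction j arbitrary: q)
  case 0
  have "((\<lambda>t::real. t ^ (2 * q)) has_integral
      1 ^ (2 * q + 1) / real (2 * q + 1) - (-1) ^ (2 * q + 1) / real (2 * q + 1)) {-1..1}"
    by (intro fundamental_theorem_of_calculus)
       (auto intro!: derivative_eq_intros simp flip: has_real_derivative_iff_has_vector_derivative
         simp: nonzero_divide_eq_eq simp del: power_Suc)
  then show ?case by simp
next
  case (Suc j)
  let ?J = "2 * 4 ^ j * fact j * fact (j + Suc q) * fact (2 * Suc q) / (fact (Suc q) * fact (2 * (j + Suc q) + 1)) :: real"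
  let ?f = "\<lambda>t::real. (1 - t\<^sup>2) ^ Suc j * t ^ (2 * q)"
  have "((\<lambda>t. real (2 * q + 1) * ?f t - 2 * real (Suc j) * ((1 - t\<^sup>2) ^ j * t ^ (2 * Suc q))) has_integral
      (1 - 1\<^sup>2) ^ Suc j * 1 ^ (2 * q + 1) - (1 - (-1)\<^sup>2) ^ Suc j * (-1) ^ (2 * q + 1)) {-1..1}"
  proof (rule fundamental_theorem_of_calculus)
    fix t :: real
    have "((\<lambda>t. (1 - t\<^sup>2) ^ Suc j * t ^ (2 * q + 1)) has_real_derivative
        (1 - t\<^sup>2) ^ Suc j * (real (2 * q + 1) * t ^ (2 * q)) + real (Suc j) * (1 - t\<^sup>2) ^ j * (- (2 * t)) * t ^ (2 * q + 1))
        (at t within {-1..1})"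
      by (auto intro!: derivative_eq_intros simp del: power_Suc)
    moreover have "(1 - t\<^sup>2) ^ Suc j * (real (2 * q + 1) * t ^ (2 * q)) + real (Suc j) * (1 - t\<^sup>2) ^ j * (- (2 * t)) * t ^ (2 * q + 1)
       = real (2 * q + 1) * ?f t - 2 * real (Suc j) * ((1 - t\<^sup>2) ^ j * t ^ (2 * Suc q))"
      by (simp add: algebra_simps)
    ultimately show "((\<lambda>t. (1 - t\<^sup>2) ^ Suc j * t ^ (2 * q + 1)) has_vector_derivative
        real (2 * q + 1) * ?f t - 2 * real (Suc j) * ((1 - t\<^sup>2) ^ j * t ^ (2 * Suc q))) (at t within {-1..1})"
      by (simp only: has_real_derivative_iff_has_vector_derivative)
  qed simp
  from has_integral_add[OF this has_integral_mult_right[OF Suc.IH[of "Suc q"], of "2 * real (Suc j)"]]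
  have "((\<lambda>t. real (2 * q + 1) * ?f t) has_integral 2 * real (Suc j) * ?J) {-1..1}"
    by simp
  from has_integral_mult_right[OF this, of "1 / real (2 * q + 1)"]
  have "(?f has_integral 1 / real (2 * q + 1) * (2 * real (Suc j) * ?J)) {-1..1}"
    by simp
  moreover have "1 / real (2 * q + 1) * (2 * real (Suc j) * ?J)
     = 2 * 4 ^ Suc j * fact (Suc j) * fact (Suc j + q) * fact (2 * q) / (fact q * fact (2 * (Suc j + q) + 1))"
  proof -
    define A B where "A = (fact (j + Suc q) :: real)" and "B = (fact (2 * (j + Suc q) + 1) :: real)"
    have "B > 0" by (simp add: B_def)
    have AB: "fact (Suc j + q) = A" "fact (2 * (Suc j + q) + 1) = B" by (simp_all add: A_def B_def)
    have "fact (2 * Suc q) = (2 * real q + 2) * ((2 * real q + 1) * (fact (2 * q) :: real))"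
      by (simp add: algebra_simps)
    then show ?thesis
      unfolding AB A_def[symmetric] B_def[symmetric] using \<open>B > 0\<close>
      by (simp add: divide_simps) (simp add: algebra_simps)
  qed
  ultimately show ?case by simp
qed

lemma has_integral_odd_monomial:
  "((\<lambda>t::real. (1 - t\<^sup>2) ^ j * t ^ (2 * q + 1)) has_integral 0) {-1..1}"
proof -
  let ?f = "\<lambda>t::real. (1 - t\<^sup>2) ^ j * t ^ (2 * q + 1)"
  have f: "(?f has_integral integral {-1..1} ?f) {-1..1}"
    by (intro integrable_integral integrable_continuous_interval continuous_intros)
  then have "((\<lambda>t. ?f (- t)) has_integral integral {-1..1} ?f) {-1..1}"
    using has_integral_reflect_real[of ?f _ 1 "-1"] by simp
  then have "((\<lambda>t. - ?f t) has_integral integral {-1..1} ?f) {-1..1}"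
    by simp
  with has_integral_neg[OF f] have "integral {-1..1} ?f = - integral {-1..1} ?f"
    by (rule has_integral_unique[rotated])
  with f show ?thesis by simp
qed

text \<open>Termwise integration: the trinomial coefficients times the Beta integrals collapse to 2
  / (M + 1) times the binomial coefficients of the power of \<rho> + c^2. For odd M every term is an
  odd function.\<close>

lemma has_integral_central_trinomial:
  fixes \<rho> c :: complex
  shows "((\<lambda>t. central_trinomial M (\<rho> / 4 * of_real (1 - t\<^sup>2)) (c * of_real t)) has_integral
    (if even M then 2 / of_nat (M + 1) * (\<rho> + c\<^sup>2) ^ (M div 2) else 0)) {-1..1}"
proof -
  let ?c = "\<lambda>j. of_nat ((M choose (2 * j)) * ((2 * j) choose j)) * (\<rho> / 4) ^ j * c ^ (M - 2 * j)"
  have expand: "central_trinomial M (\<rho> / 4 * of_real (1 - t\<^sup>2)) (c * of_real t)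
      = (\<Sum>j\<le>M div 2. ?c j * of_real ((1 - t\<^sup>2) ^ j * t ^ (M - 2 * j)))" for t
    unfolding central_trinomial_def of_real_mult of_real_power power_mult_distrib
    by (intro sum.cong) (simp_all only: mult_ac)
  show ?thesis
  proof (cases "even M")
    case True
    then obtain p where M: "M = 2 * p" by blast
    let ?J = "\<lambda>j. 2 * 4 ^ j * fact j * fact p * fact (2 * (p - j)) / (fact (p - j) * fact (2 * p + 1)) :: real"
    have "((\<lambda>t. \<Sum>j\<le>p. ?c j * of_real ((1 - t\<^sup>2) ^ j * t ^ (M - 2 * j))) has_integral
        (\<Sum>j\<le>p. ?c j * of_real (?J j))) {-1..1}"
    proof (intro has_integral_sum has_integral_mult_right has_integral_of_real)
      fix j assume "j \<in> {..p}"
      then have "M - 2 * j = 2 * (p - j)" "j + (p - j) = p" by (auto simp: M)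
      then show "((\<lambda>t. (1 - t\<^sup>2) ^ j * t ^ (M - 2 * j)) has_integral ?J j) {-1..1}"
        using has_integral_even_monomial[of j "p - j"] by simp
    qed simp
    moreover have "(\<Sum>j\<le>p. ?c j * of_real (?J j)) = 2 / of_nat (M + 1) * (\<rho> + c\<^sup>2) ^ p"
    proof -
      have "?c j * of_real (?J j) = 2 / of_nat (M + 1) * (of_nat (p choose j) * \<rho> ^ j * (c\<^sup>2) ^ (p - j))"
        if "j \<le> p" for j
      proof -
        have e: "2 * p - 2 * j = 2 * (p - j)" "2 * j - j = j" by auto
        have "real ((M choose (2 * j)) * ((2 * j) choose j)) / 4 ^ j * ?J j = 2 / real (M + 1) * real (p choose j)"
        proof -
          have "real (M choose (2 * j)) = fact (2 * p) / (fact (2 * j) * fact (2 * (p - j)))"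
            using binomial_fact[of "2 * j" M, where ?'a = real] that by (simp add: M e)
          moreover have "real ((2 * j) choose j) = fact (2 * j) / (fact j * fact j)"
            using binomial_fact[of j "2 * j", where ?'a = real] by (simp add: e)
          moreover have "real (p choose j) = fact p / (fact j * fact (p - j))"
            using binomial_fact[of j p, where ?'a = real] that by simp
          moreover have "fact (2 * p + 1) = real (M + 1) * fact (2 * p)"
            by (simp add: M)
          ultimately show ?thesis
            by (simp only: of_nat_mult) (simp add: divide_simps del: of_nat_add of_nat_Suc)
        qed
        from arg_cong[OF this, of complex_of_real]
        have *: "of_nat ((M choose (2 * j)) * ((2 * j) choose j)) / 4 ^ j * of_real (?J j) = 2 / of_nat (M + 1) * (of_nat (p choose j) :: complex)"
          by (simp only: of_real_mult of_real_divide of_real_power of_real_of_nat_eq of_real_numeral)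
        have "?c j * of_real (?J j) = (of_nat ((M choose (2 * j)) * ((2 * j) choose j)) / 4 ^ j * of_real (?J j)) * (\<rho> ^ j * (c\<^sup>2) ^ (p - j))"
          by (simp only: power_divide M e power_mult) (simp only: times_divide_eq_left times_divide_eq_right mult_ac)
        then show ?thesis
          unfolding * by (simp only: mult.assoc)
      qed
      then show ?thesis
        by (simp add: binomial_ring sum_distrib_left)
    qed
    ultimately show ?thesis
      unfolding expand using M by simp
  next
    case False
    have "((\<lambda>t. \<Sum>j\<le>M div 2. ?c j * of_real ((1 - t\<^sup>2) ^ j * t ^ (M - 2 * j))) has_integral
        (\<Sum>j\<le>M div 2. ?c j * of_real 0)) {-1..1}"
    proof (intro has_integral_sum has_integral_mult_right has_integral_of_real)
      fix j assume "j \<in> {..M div 2}"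
      with False have "M - 2 * j = 2 * (M div 2 - j) + 1" by (auto elim!: oddE)
      then show "((\<lambda>t::real. (1 - t\<^sup>2) ^ j * t ^ (M - 2 * j)) has_integral 0) {-1..1}"
        using has_integral_odd_monomial[of j "M div 2 - j"] by simp
    qed simp
    then show ?thesis
      unfolding expand using False by simp
  qed
qed

text \<open>That only a^2 + b^2 + c^2 enters, for complex coefficients too, takes the place of
  rotation invariance.\<close>

lemma integral_power_linear_form:
  "(LINT y|sphere_measure. linear_form a b c y ^ M) =
     (if even M then of_real (4 * pi) / of_nat (M + 1) * (a\<^sup>2 + b\<^sup>2 + c\<^sup>2) ^ (M div 2) else 0)"
proof -
  have "(LINT y|sphere_measure. linear_form a b c y ^ M) =
     of_real (2 * pi) * (if even M then 2 / of_nat (M + 1) * (a\<^sup>2 + b\<^sup>2 + c\<^sup>2) ^ (M div 2) else 0)"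
    using integral_polar_power_linear_form[of 0 a b c M]
    by (simp only: power_0 mult_1_left integral_unique[OF has_integral_central_trinomial])
  then show ?thesis by simp
qed

text \<open>Compare the coefficients of \<open>\<tau> ^ n\<close> in the moments of the form \<open>x + \<tau> a\<close>, whose
  square \<open>1 + 2 * \<tau> * (x \<bullet> a)\<close> is linear in \<open>\<tau>\<close> because \<open>a\<close> is isotropic.\<close>

lemma ex_integral_inner_power_isotropic:
  "\<exists>K. \<forall>x \<in> sphere 0 1. \<forall>a b c. a\<^sup>2 + b\<^sup>2 + c\<^sup>2 = 0 \<longrightarrow>
     (LINT y|sphere_measure. of_real (x \<bullet> y) ^ N * linear_form a b c y ^ n) = K * linear_form a b c x ^ n"
proof -
  let ?M = "N + n"
  define L where "L = (if even ?M then of_real (4 * pi) / of_nat (?M + 1) else (0::complex))"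
  \<comment> \<open>With s the value of the isotropic form at x, the coefficient of \<tau>^n in L (1
    + 2 \<tau> s)^(M div 2) is L 2^n s^n times a binomial coefficient. Division by the binomial
    weight on the other side gives K, which involves neither x nor the form.\<close>
  define K where "K = L * 2 ^ n * coeff ([:1, 1:] ^ (?M div 2)) n / of_nat (?M choose n)"
  have "(LINT y|sphere_measure. of_real (x \<bullet> y) ^ N * linear_form a b c y ^ n) = K * linear_form a b c x ^ n"
    if x: "x \<in> sphere 0 1" and iso: "a\<^sup>2 + b\<^sup>2 + c\<^sup>2 = 0" for x a b c
  proof -
    let ?I = "\<lambda>k. LINT y|sphere_measure. of_real (x \<bullet> y) ^ (?M - k) * linear_form a b c y ^ k"
    let ?s = "linear_form a b c x"
    let ?p = "\<Sum>k\<le>?M. monom (of_nat (?M choose k) * ?I k) k"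
    let ?q = "smult L (pcompose ([:1, 1:] ^ (?M div 2)) [:0, 2 * ?s:])"
    have int: "integrable sphere_measure (\<lambda>y. of_real (x \<bullet> y) ^ i * linear_form a b c y ^ j)" for i j
      by (intro integrable_sphere_measure continuous_intros)
    have x1: "of_real (x $ 1) ^ 2 + of_real (x $ 2) ^ 2 + of_real (x $ 3) ^ 2 = (1::complex)"
    proof -
      have "(x $ 1)\<^sup>2 + (x $ 2)\<^sup>2 + (x $ 3)\<^sup>2 = 1"
        using x by (simp add: norm_vec_def L2_set_def sum_3)
      from arg_cong[OF this, of complex_of_real] show ?thesis by simp
    qed
    have "poly ?p \<tau> = poly ?q \<tau>" for \<tau>
    proof -
      let ?a = "of_real (x $ 1) + \<tau> * a" and ?b = "of_real (x $ 2) + \<tau> * b" and ?c = "of_real (x $ 3) + \<tau> * c"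
      have "?a\<^sup>2 + ?b\<^sup>2 + ?c\<^sup>2 = (of_real (x $ 1) ^ 2 + of_real (x $ 2) ^ 2 + of_real (x $ 3) ^ 2)
          + 2 * \<tau> * ?s + \<tau>\<^sup>2 * (a\<^sup>2 + b\<^sup>2 + c\<^sup>2)"
        by (simp add: linear_form_def algebra_simps power2_eq_square)
      then have sq: "?a\<^sup>2 + ?b\<^sup>2 + ?c\<^sup>2 = 1 + 2 * \<tau> * ?s"
        by (simp add: x1 iso)
      have "poly ?p \<tau> = (\<Sum>k\<le>?M. ?I k * (of_nat (?M choose k) * \<tau> ^ k))"
        by (simp add: poly_sum poly_monom mult_ac)
      also have "\<dots> = (LINT y|sphere_measure. (\<Sum>k\<le>?M. of_real (x \<bullet> y) ^ (?M - k) * linear_form a b c y ^ k * (of_nat (?M choose k) * \<tau> ^ k)))"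
        using int by (subst Bochner_Integration.integral_sum) simp_all
      also have "\<dots> = (LINT y|sphere_measure. linear_form ?a ?b ?c y ^ ?M)"
      proof (rule Bochner_Integration.integral_cong)
        fix y :: "real^3"
        have "linear_form ?a ?b ?c y = \<tau> * linear_form a b c y + of_real (x \<bullet> y)"
          by (simp add: linear_form_def inner_vec_def sum_3 algebra_simps)
        then show "(\<Sum>k\<le>?M. of_real (x \<bullet> y) ^ (?M - k) * linear_form a b c y ^ k * (of_nat (?M choose k) * \<tau> ^ k))
            = linear_form ?a ?b ?c y ^ ?M"
          by (simp add: binomial_ring power_mult_distrib mult_ac)
      qed simp
      also have "\<dots> = L * (1 + 2 * \<tau> * ?s) ^ (?M div 2)"
        unfolding integral_power_linear_form sq by (simp add: L_def)
      also have "\<dots> = poly ?q \<tau>"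
        by (simp add: poly_pcompose mult_ac)
      finally show ?thesis .
    qed
    then have "poly ?p = poly ?q" ..
    then have "coeff ?p n = coeff ?q n"
      by (simp only: poly_eq_poly_eq_iff)
    moreover have "coeff ?p n = of_nat (?M choose n) * ?I n"
      by (simp add: coeff_sum sum.delta)
    moreover have "coeff ?q n = K * ?s ^ n * of_nat (?M choose n)"
      by (simp add: coeff_pcompose_linear K_def power_mult_distrib)
    ultimately have "of_nat (?M choose n) * ?I n = of_nat (?M choose n) * (K * ?s ^ n)"
      by (simp only: mult_ac)
    then show ?thesis by simp
  qed
  then show ?thesis by blast
qed

text \<open>As K is the same for all x and all isotropic vectors, it is read off at the north pole
  with the vector (i, 0, 1), whose form takes the value 1 there. The polar formula then shows P_n as
  a central trinomial.\<close>

lemma integral_inner_power_isotropic: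
  assumes x: "x \<in> sphere 0 1" and iso: "a\<^sup>2 + b\<^sup>2 + c\<^sup>2 = 0"
  shows "(LINT y|sphere_measure. of_real (x \<bullet> y) ^ N * linear_form a b c y ^ n) =
     of_real (2 * pi) * integral {-1..1} (\<lambda>t. of_real t ^ N * of_real (poly (legendre_poly n) t)) * linear_form a b c x ^ n"
proof -
  obtain K where K: "\<And>x a b c. x \<in> sphere 0 1 \<Longrightarrow> a\<^sup>2 + b\<^sup>2 + c\<^sup>2 = 0 \<Longrightarrow>
     (LINT y|sphere_measure. of_real (x \<bullet> y) ^ N * linear_form a b c y ^ n) = K * linear_form a b c x ^ n"
    using ex_integral_inner_power_isotropic[of N n] by blast
  have "K = (LINT y|sphere_measure. of_real (axis 3 1 \<bullet> y) ^ N * linear_form \<i> 0 1 y ^ n)"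
    by (subst K) (simp_all add: linear_form_def norm_axis_1, simp_all add: axis_def)
  also have "\<dots> = of_real (2 * pi) * integral {-1..1} (\<lambda>t. of_real t ^ N * central_trinomial n ((\<i>\<^sup>2 + 0\<^sup>2) / 4 * of_real (1 - t\<^sup>2)) (1 * of_real t))"
    unfolding inner_axis' by (simp only: mult_1_left inner_real_def integral_polar_power_linear_form)
  also have "(\<lambda>t. of_real t ^ N * central_trinomial n ((\<i>\<^sup>2 + 0\<^sup>2) / 4 * of_real (1 - t\<^sup>2)) (1 * of_real t))
     = (\<lambda>t. of_real t ^ N * of_real (poly (legendre_poly n) t))"
  proof -
    have "(\<i>\<^sup>2 + 0\<^sup>2) / 4 * of_real (1 - t\<^sup>2) = of_real (- (1 - t\<^sup>2) / 4)" for t :: real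
      by (simp add: field_simps)
    then show ?thesis
      by (simp only: legendre_poly_eq_central_trinomial of_real_central_trinomial mult_1_left)
  qed
  finally show ?thesis
    using K[OF x iso] by simp
qed

section \<open>The Funk-Hecke formula for continuous kernels\<close>

text \<open>The difference E of the two sides is linear in g, is bounded by a constant times any
  bound for g on \<open>{-1..1}\<close>, and vanishes on monomials. Weierstrass approximation does
  the rest.\<close>

lemma integral_continuous_isotropic:
  fixes g :: "real \<Rightarrow> complex"
  assumes g: "continuous_on UNIV g" and x: "x \<in> sphere 0 1" and iso: "a\<^sup>2 + b\<^sup>2 + c\<^sup>2 = 0"
  shows "(LINT y|sphere_measure. g (x \<bullet> y) * linear_form a b c y ^ n) =
     of_real (2 * pi) * integral {-1..1} (\<lambda>t. g t * of_real (poly (legendre_poly n) t)) * linear_form a b c x ^ n"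
proof -
  let ?P = "\<lambda>t. of_real (poly (legendre_poly n) t) :: complex"
  let ?h = "\<lambda>y. linear_form a b c y ^ n"
  define E where "E g = (LINT y|sphere_measure. g (x \<bullet> y) * ?h y) -
     of_real (2 * pi) * integral {-1..1} (\<lambda>t. g t * ?P t) * ?h x" for g
  define K where "K = (LINT y|sphere_measure. norm (?h y)) + 2 * pi * integral {-1..1} (\<lambda>t. norm (?P t)) * norm (?h x)"
  have int1: "integrable sphere_measure (\<lambda>y. f (x \<bullet> y) * ?h y)" if "continuous_on UNIV f" for f :: "real \<Rightarrow> complex"
    by (intro integrable_sphere_measure continuous_intros continuous_on_compose2[OF that]) auto
  have contP: "continuous_on A ?P" for A
    by (intro continuous_intros)
  have int2: "(\<lambda>t. f t * ?P t) integrable_on {-1..1}" if "continuous_on UNIV f" for f :: "real \<Rightarrow> complex"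
    by (intro integrable_continuous_interval continuous_on_mult continuous_on_subset[OF that] contP) auto
  have E_add: "E (\<lambda>t. f t + f' t) = E f + E f'" if "continuous_on UNIV f" "continuous_on UNIV f'" for f f'
    using that by (simp add: E_def distrib_right Bochner_Integration.integral_add int1 int2
      Henstock_Kurzweil_Integration.integral_add algebra_simps)
  have E_mult: "E (\<lambda>t. z * f t) = z * E f" for f z
    by (simp add: E_def mult.assoc right_diff_distrib)
  have E_bound: "norm (E f) \<le> B * K" if f: "continuous_on UNIV f" and B: "\<And>t. t \<in> {-1..1} \<Longrightarrow> norm (f t) \<le> B" for f B
  proof -
    have "norm (LINT y|sphere_measure. f (x \<bullet> y) * ?h y) \<le> (LINT y|sphere_measure. norm (f (x \<bullet> y) * ?h y))"
      by (rule Bochner_Integration.integral_norm_bound)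
    also have "\<dots> \<le> (LINT y|sphere_measure. B * norm (?h y))"
    proof (rule integral_mono_AE)
      show "integrable sphere_measure (\<lambda>y. norm (f (x \<bullet> y) * ?h y))"
        by (intro integrable_norm int1 f)
      show "integrable sphere_measure (\<lambda>y. B * norm (?h y))"
        by (intro integrable_sphere_measure continuous_intros)
      show "AE y in sphere_measure. norm (f (x \<bullet> y) * ?h y) \<le> B * norm (?h y)"
        using AE_sphere_measure
      proof eventually_elim
        case (elim y)
        then have "x \<bullet> y \<in> {-1..1}"
          using Cauchy_Schwarz_ineq2[of x y] x by (auto simp: abs_le_iff)
        from B[OF this] show ?case
          by (simp add: norm_mult mult_right_mono)
      qed
    qed
    finally have 1: "norm (LINT y|sphere_measure. f (x \<bullet> y) * ?h y) \<le> B * (LINT y|sphere_measure. norm (?h y))"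
      by simp
    have "norm (integral {-1..1} (\<lambda>t. f t * ?P t)) \<le> integral {-1..1} (\<lambda>t. B * norm (?P t))"
    proof (rule Henstock_Kurzweil_Integration.integral_norm_bound_integral)
      show "(\<lambda>t. B * norm (?P t)) integrable_on {-1..1}"
        by (intro integrable_continuous_interval continuous_intros)
      show "norm (f t * ?P t) \<le> B * norm (?P t)" if "t \<in> {-1..1}" for t
        using B[OF that] by (simp add: norm_mult mult_right_mono del: norm_of_real)
    qed (rule int2[OF f])
    also have "\<dots> = B * integral {-1..1} (\<lambda>t. norm (?P t))"
      by simp
    finally have "norm (of_real (2 * pi) * integral {-1..1} (\<lambda>t. f t * ?P t) * ?h x)
        \<le> 2 * pi * (B * integral {-1..1} (\<lambda>t. norm (?P t))) * norm (?h x)"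
      unfolding norm_mult by (intro mult_right_mono mult_mono) auto
    with 1 show ?thesis
      unfolding E_def K_def by (intro order.trans[OF norm_triangle_ineq4]) (simp add: algebra_simps)
  qed
  have E_pow: "E (\<lambda>t. of_real t ^ i) = 0" for i
    using integral_inner_power_isotropic[OF x iso, of i n] by (simp add: E_def)
  have E_poly: "E (\<lambda>t. \<Sum>i\<le>m. w i * of_real t ^ i) = 0" for w :: "nat \<Rightarrow> complex" and m
  proof (induction m)
    case 0
    then show ?case using E_mult[of "w 0" "\<lambda>t. of_real t ^ 0"] E_pow[of 0] by simp
  next
    case (Suc m)
    have "E (\<lambda>t. \<Sum>i\<le>Suc m. w i * of_real t ^ i)
       = E (\<lambda>t. \<Sum>i\<le>m. w i * of_real t ^ i) + E (\<lambda>t. w (Suc m) * of_real t ^ Suc m)"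
      unfolding sum.atMost_Suc by (intro E_add continuous_intros)
    then show ?case
      by (simp only: Suc.IH E_mult E_pow) simp
  qed
  \<comment> \<open>Only real kernels are approximated; a complex one is split into real and
    imaginary part at the end.\<close>
  have approx: "\<exists>w m. \<forall>t \<in> {-1..1}. norm (of_real (f t) - (\<Sum>i\<le>m. w i * of_real t ^ i) :: complex) < e"
    if f: "continuous_on UNIV f" and e: "e > 0" for f :: "real \<Rightarrow> real" and e
  proof -
    obtain p where p: "real_polynomial_function p" "\<And>t. t \<in> {-1..1} \<Longrightarrow> \<bar>f t - p t\<bar> < e"
      by (rule Stone_Weierstrass_real_polynomial_function[of "{-1..1::real}" f e])
         (use continuous_on_subset[OF f] e in auto)
    then obtain w m where "p = (\<lambda>t. \<Sum>i\<le>m. w i * t ^ i)"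
      by (auto simp: real_polynomial_function_iff_sum)
    then have "norm (of_real (f t) - (\<Sum>i\<le>m. of_real (w i) * of_real t ^ i) :: complex) < e" if "t \<in> {-1..1}" for t
      using p(2)[OF that] by (simp flip: of_real_power of_real_mult of_real_sum of_real_diff)
    then show ?thesis
      by (intro exI[of _ "\<lambda>i. of_real (w i)"] exI[of _ m] ballI)
  qed
  have E_real: "E (\<lambda>t. of_real (f t)) = 0" if f: "continuous_on UNIV f" for f :: "real \<Rightarrow> real"
  proof -
    have "norm (E (\<lambda>t. of_real (f t))) \<le> e * K" if "e > 0" for e
    proof -
      obtain w m where wm: "\<And>t. t \<in> {-1..1} \<Longrightarrow> norm (of_real (f t) - (\<Sum>i\<le>m. w i * of_real t ^ i) :: complex) < e"
        using approx[OF f \<open>e > 0\<close>] by blast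
      let ?p = "\<lambda>t::real. \<Sum>i\<le>m. w i * of_real t ^ i"
      have "E (\<lambda>t. (of_real (f t) - ?p t) + ?p t) = E (\<lambda>t. of_real (f t) - ?p t) + E ?p"
        by (intro E_add continuous_intros f)
      moreover have "norm (E (\<lambda>t. of_real (f t) - ?p t)) \<le> e * K"
        using wm by (intro E_bound continuous_intros f) (auto intro: less_imp_le)
      ultimately show ?thesis
        by (simp add: E_poly)
    qed
    moreover have "((\<lambda>e. e * K) \<longlongrightarrow> 0 * K) (at_right 0)"
      by (intro tendsto_intros)
    ultimately have "norm (E (\<lambda>t. of_real (f t))) \<le> 0 * K"
      by (intro tendsto_lowerbound[of "\<lambda>e. e * K" _ "at_right 0"])
         (auto simp: eventually_at_right_less intro: eventually_at_rightI[of 0 1])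
    then show ?thesis by simp
  qed
  have "E (\<lambda>t. of_real (Re (g t))) = 0" "E (\<lambda>t. of_real (Im (g t))) = 0"
    by (intro E_real continuous_intros g)+
  then have "E (\<lambda>t. of_real (Re (g t)) + \<i> * of_real (Im (g t))) = 0"
    by (subst E_add) (auto simp: E_mult intro!: continuous_intros g)
  then have "E g = 0"
    by (simp add: complex_eq[symmetric])
  then show ?thesis by (simp add: E_def)
qed

section \<open>The chord length and its inverse\<close>

definition chord :: "real \<Rightarrow> real" where
  "chord t = sqrt (2 * (1 - t))"

text \<open>HOL's \<open>sqrt\<close> is odd and continuous on the whole line, so
  \<open>chord\<close> is continuous everywhere, with negative values beyond t = 1.\<close>

lemma continuous_on_chord [continuous_intros]: "continuous_on A chord"
  unfolding chord_def by (intro continuous_intros)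

lemma dist_sphere_eq_chord:
  assumes "norm x = 1" "norm y = 1"
  shows "dist x y = chord (x \<bullet> y)"
proof -
  have "x \<bullet> x = 1" "y \<bullet> y = 1" using assms by (simp_all add: norm_eq_1)
  then show ?thesis
    by (simp add: dist_norm norm_eq_sqrt_inner chord_def inner_diff_left inner_diff_right inner_commute)
qed

lemma chord_deriv:
  assumes "t < 1"
  shows "(chord has_real_derivative - 1 / chord t) (at t within A)"
proof -
  have "chord t > 0" using assms by (simp add: chord_def)
  then show ?thesis
    unfolding chord_def using assms
    by (auto intro!: derivative_eq_intros simp: field_simps)
qed

text \<open>The negative of \<open>chord\<close> is an antiderivative on the open interval and
  continuous up to t = 1, where the integrand is unbounded; hence the interior form of the
  fundamental theorem.\<close>

lemma has_integral_inverse_chord: "((\<lambda>t. 1 / chord t) has_integral 2) {-1..1}"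
proof -
  have "((\<lambda>t. 1 / chord t) has_integral (- chord 1 - - chord (-1))) {-1..1}"
  proof (rule fundamental_theorem_of_calculus_interior)
    fix t :: real assume "t \<in> {-1<..<1}"
    then have "((\<lambda>t. - chord t) has_real_derivative - (- 1 / chord t)) (at t)"
      by (intro DERIV_minus chord_deriv) simp
    then show "((\<lambda>t. - chord t) has_vector_derivative 1 / chord t) (at t)"
      by (simp add: has_real_derivative_iff_has_vector_derivative)
  qed (auto intro!: continuous_intros)
  then show ?thesis by (simp add: chord_def)
qed

text \<open>Continuous kernels increasing to \<open>1 / chord\<close>, with the value \<open>0 = 1 / 0\<close> at \<open>t = 1\<close>.\<close>

definition chord_approx :: "nat \<Rightarrow> real \<Rightarrow> real" where
  "chord_approx i t = chord t / ((chord t)\<^sup>2 + 1 / real (Suc i))"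

lemma chord_approx_denom_pos: "(chord t)\<^sup>2 + 1 / real (Suc i) > 0"
  by (intro add_nonneg_pos) auto

lemma continuous_on_chord_approx: "continuous_on A (chord_approx i)"
  unfolding chord_approx_def using chord_approx_denom_pos
  by (intro continuous_intros) (metis less_irrefl)

lemma chord_approx_nonneg: "t \<le> 1 \<Longrightarrow> 0 \<le> chord_approx i t"
  unfolding chord_approx_def using chord_approx_denom_pos[of t i]
  by (intro divide_nonneg_pos) (auto simp: chord_def)

lemma chord_approx_le:
  assumes "t \<le> 1"
  shows "chord_approx i t \<le> 1 / chord t"
proof (cases "chord t = 0")
  case False
  then have "chord t > 0" using assms by (simp add: chord_def)
  then show ?thesis
    unfolding chord_approx_def using chord_approx_denom_pos[of t i]
    by (simp add: divide_le_eq field_simps power2_eq_square)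
qed (simp add: chord_approx_def)

lemma chord_approx_mono:
  assumes "t \<le> 1"
  shows "mono (\<lambda>i. chord_approx i t)"
proof (rule monoI)
  fix i j :: nat assume "i \<le> j"
  then have "(chord t)\<^sup>2 + 1 / real (Suc j) \<le> (chord t)\<^sup>2 + 1 / real (Suc i)"
    by (intro add_left_mono frac_le) auto
  moreover have "0 \<le> chord t"
    using assms by (simp add: chord_def)
  ultimately show "chord_approx i t \<le> chord_approx j t"
    unfolding chord_approx_def
    by (intro divide_left_mono mult_pos_pos chord_approx_denom_pos)
qed

lemma chord_approx_tendsto: "(\<lambda>i. chord_approx i t) \<longlonglongrightarrow> 1 / chord t"
proof (cases "chord t = 0")
  case False
  have "(\<lambda>i. chord t / ((chord t)\<^sup>2 + inverse (real (Suc i)))) \<longlonglongrightarrow> chord t / ((chord t)\<^sup>2 + 0)"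
    using False by (intro tendsto_intros LIMSEQ_inverse_real_of_nat) auto
  then show ?thesis
    using False by (simp add: chord_approx_def power2_eq_square inverse_eq_divide)
qed (simp add: chord_approx_def)

lemma inner_sphere_le_1: "norm x = 1 \<Longrightarrow> norm y = 1 \<Longrightarrow> \<bar>x \<bullet> y\<bar> \<le> 1"
  using Cauchy_Schwarz_ineq2[of x y] by simp

text \<open>Monotone convergence along \<open>chord_approx\<close>. The formula for continuous
  kernels with n = 0 turns the surface integrals into integrals over \<open>{-1..1}\<close>, whose
  convergence follows from \<open>has_integral_inverse_chord\<close>.\<close>

lemma integrable_inverse_chord:
  assumes x: "x \<in> sphere 0 1"
  shows "integrable sphere_measure (\<lambda>y. 1 / chord (x \<bullet> y))"
proof (rule integrable_monotone_convergence)
  let ?f = "\<lambda>i y. chord_approx i (x \<bullet> y)"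
  show "integrable sphere_measure (?f i)" for i
    by (intro integrable_sphere_measure continuous_on_compose2[OF continuous_on_chord_approx[of UNIV]] continuous_intros) auto
  show "AE y in sphere_measure. mono (\<lambda>i. ?f i y)"
    using AE_sphere_measure
  proof eventually_elim
    case (elim y)
    then show ?case using inner_sphere_le_1[of x y] x by (intro chord_approx_mono) auto
  qed
  show "AE y in sphere_measure. (\<lambda>i. ?f i y) \<longlonglongrightarrow> 1 / chord (x \<bullet> y)"
    by (simp add: chord_approx_tendsto)
  have "(LINT y|sphere_measure. ?f i y) = 2 * pi * integral {-1..1} (chord_approx i)" for i
  proof -
    \<comment> \<open>The zero form is isotropic and its power 0 is the constant 1.\<close>
    have "of_real (LINT y|sphere_measure. ?f i y) = (LINT y|sphere_measure. of_real (?f i y) * linear_form 0 0 0 y ^ 0)"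
      by simp
    also have "\<dots> = of_real (2 * pi) * integral {-1..1} (\<lambda>t. of_real (chord_approx i t) * of_real (poly (legendre_poly 0) t)) * linear_form 0 0 0 x ^ 0"
      by (rule integral_continuous_isotropic[OF _ x]) (auto intro!: continuous_intros continuous_on_chord_approx)
    also have "\<dots> = of_real (2 * pi) * integral {-1..1} (\<lambda>t. of_real (chord_approx i t))"
      by (simp add: legendre_poly_def)
    also have "integral {-1..1} (\<lambda>t. of_real (chord_approx i t)) = (of_real (integral {-1..1} (chord_approx i)) :: complex)"
      by (intro integral_unique has_integral_of_real integrable_integral integrable_continuous_interval continuous_on_chord_approx)
    finally show ?thesis
      by (simp only: of_real_mult[symmetric] of_real_eq_iff)
  qed
  moreover have "(\<lambda>i. integral {-1..1} (chord_approx i)) \<longlonglongrightarrow> integral {-1..1} (\<lambda>t. 1 / chord t)"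
    by (rule Equivalence_Lebesgue_Henstock_Integration.dominated_convergence(2)[where h = "\<lambda>t. 1 / chord t"])
       (auto intro!: chord_approx_tendsto integrable_continuous_interval continuous_on_chord_approx
          has_integral_integrable[OF has_integral_inverse_chord] chord_approx_le simp: chord_approx_nonneg)
  ultimately show "(\<lambda>i. LINT y|sphere_measure. ?f i y) \<longlonglongrightarrow> 2 * pi * integral {-1..1} (\<lambda>t. 1 / chord t)"
    by (simp add: tendsto_mult_left)
  have "continuous_on UNIV (\<lambda>y. chord (x \<bullet> y))"
    by (intro continuous_on_compose2[OF continuous_on_chord[of UNIV]] continuous_intros) auto
  then have [measurable]: "(\<lambda>y. chord (x \<bullet> y)) \<in> borel_measurable borel"
    by (rule borel_measurable_continuous_onI)
  show "(\<lambda>y. 1 / chord (x \<bullet> y)) \<in> borel_measurable sphere_measure"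
    by measurable
qed

section \<open>The Funk-Hecke formula for weakly singular kernels\<close>

lemma continuous_on_comp_inner:
  fixes x :: "'a::real_inner"
  assumes "continuous_on UNIV A"
  shows "continuous_on S (\<lambda>y. A (x \<bullet> y))"
  by (intro continuous_on_compose2[OF assms] continuous_intros) auto

text \<open>The numerator is continuous, hence bounded on the sphere, so a multiple of the inverse
  chord dominates.\<close>

lemma integrable_weakly_singular:
  fixes A :: "real \<Rightarrow> complex" and h :: "real^3 \<Rightarrow> complex"
  assumes A: "continuous_on UNIV A" and h: "continuous_on UNIV h" and x: "x \<in> sphere 0 1"
  shows "integrable sphere_measure (\<lambda>y. A (x \<bullet> y) / of_real (chord (x \<bullet> y)) * h y)"
proof -
  have cont: "continuous_on S (\<lambda>y. A (x \<bullet> y) * h y)" for S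
    by (intro continuous_intros continuous_on_comp_inner A continuous_on_subset[OF h]) auto
  then have "compact ((\<lambda>y. A (x \<bullet> y) * h y) ` sphere 0 1)"
    by (intro compact_continuous_image) auto
  then obtain C where "\<forall>z \<in> (\<lambda>y. A (x \<bullet> y) * h y) ` sphere 0 1. norm z \<le> C"
    using compact_imp_bounded bounded_iff by blast
  then have C: "norm (A (x \<bullet> y) * h y) \<le> C" if "norm y = 1" for y
    using that by simp
  have [measurable]: "(\<lambda>y. A (x \<bullet> y) * h y) \<in> borel_measurable borel"
    by (rule borel_measurable_continuous_onI[OF cont])
  have [measurable]: "(\<lambda>y. chord (x \<bullet> y)) \<in> borel_measurable borel"
    by (rule borel_measurable_continuous_onI[OF continuous_on_comp_inner[OF continuous_on_chord]])
  have "integrable sphere_measure (\<lambda>y. A (x \<bullet> y) * h y / of_real (chord (x \<bullet> y)))"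
  proof (rule Bochner_Integration.integrable_bound)
    show "integrable sphere_measure (\<lambda>y. C * (1 / chord (x \<bullet> y)))"
      by (intro integrable_mult_right integrable_inverse_chord x)
    show "(\<lambda>y. A (x \<bullet> y) * h y / of_real (chord (x \<bullet> y))) \<in> borel_measurable sphere_measure"
      by measurable
    show "AE y in sphere_measure. norm (A (x \<bullet> y) * h y / of_real (chord (x \<bullet> y))) \<le> norm (C * (1 / chord (x \<bullet> y)))"
      using AE_sphere_measure
    proof eventually_elim
      case (elim y)
      then have "norm (A (x \<bullet> y) * h y) \<le> \<bar>C\<bar>" using C[of y] by linarith
      then show ?case
        by (simp only: norm_divide norm_of_real norm_mult real_norm_def abs_divide abs_1 times_divide_eq_right mult_1_right)
           (intro divide_right_mono, auto simp: norm_mult)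
    qed
  qed
  then show ?thesis by simp
qed

text \<open>The Funk-Hecke eigenvalue of the kernel \<open>A\<close> / \<open>chord\<close> in
  degree n. At t = 1 the integrand is 0 by the convention for division, a single point that does not
  affect the integral.\<close>

definition zonal_multiplier :: "(real \<Rightarrow> complex) \<Rightarrow> nat \<Rightarrow> complex" where
  "zonal_multiplier A n = of_real (2 * pi) *
     integral {-1..1} (\<lambda>t. A t / of_real (chord t) * of_real (poly (legendre_poly n) t))"

text \<open>With \<open>chord_approx\<close> in place of 1 / \<open>chord\<close> the kernel is
  continuous and dominated by the singular one. Dominated convergence carries the identity to the
  limit on both sides.\<close>

lemma integral_weakly_singular_isotropic:
  fixes A :: "real \<Rightarrow> complex"
  assumes A: "continuous_on UNIV A" and x: "x \<in> sphere 0 1" and iso: "a\<^sup>2 + b\<^sup>2 + c\<^sup>2 = 0"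
  shows "(LINT y|sphere_measure. A (x \<bullet> y) / of_real (chord (x \<bullet> y)) * linear_form a b c y ^ n) =
     zonal_multiplier A n * linear_form a b c x ^ n"
proof -
  let ?h = "\<lambda>y. linear_form a b c y ^ n" and ?P = "\<lambda>t. of_real (poly (legendre_poly n) t) :: complex"
  let ?g = "\<lambda>i t. A t * of_real (chord_approx i t)"
  have h: "continuous_on UNIV ?h" by (intro continuous_intros)
  have int: "integrable sphere_measure (\<lambda>y. A (x \<bullet> y) / of_real (chord (x \<bullet> y)) * ?h y)"
    by (rule integrable_weakly_singular[OF A h x])
  have g: "continuous_on S (?g i)" for i S
    by (intro continuous_intros continuous_on_subset[OF A] continuous_on_chord_approx) auto
  have le: "norm (?g i t * z) \<le> norm (A t / of_real (chord t) * z)" if "t \<le> 1" for i t z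
  proof -
    have "\<bar>chord_approx i t\<bar> \<le> \<bar>1 / chord t\<bar>"
      using chord_approx_nonneg[OF that, of i] chord_approx_le[OF that, of i] by linarith
    then have "norm (A t) * \<bar>chord_approx i t\<bar> * norm z \<le> norm (A t) * \<bar>1 / chord t\<bar> * norm z"
      by (intro mult_right_mono mult_left_mono) auto
    then show ?thesis by (simp add: norm_mult norm_divide)
  qed
  have lim: "(\<lambda>i. ?g i t * z) \<longlonglongrightarrow> A t / of_real (chord t) * z" for t z
    using tendsto_mult[OF tendsto_mult[OF tendsto_const[of "A t"] tendsto_of_real[OF chord_approx_tendsto[of t]]] tendsto_const[of z]]
    by simp
  have "(\<lambda>i. LINT y|sphere_measure. ?g i (x \<bullet> y) * ?h y) \<longlonglongrightarrow>
      (LINT y|sphere_measure. A (x \<bullet> y) / of_real (chord (x \<bullet> y)) * ?h y)"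
  proof (rule integral_dominated_convergence)
    show "integrable sphere_measure (\<lambda>y. norm (A (x \<bullet> y) / of_real (chord (x \<bullet> y)) * ?h y))"
      by (intro integrable_norm int)
    show "AE y in sphere_measure. norm (?g i (x \<bullet> y) * ?h y) \<le> norm (A (x \<bullet> y) / of_real (chord (x \<bullet> y)) * ?h y)" for i
      using AE_sphere_measure
    proof eventually_elim
      case (elim y)
      then show ?case using inner_sphere_le_1[of x y] x by (intro le) auto
    qed
    show "AE y in sphere_measure. (\<lambda>i. ?g i (x \<bullet> y) * ?h y) \<longlonglongrightarrow> A (x \<bullet> y) / of_real (chord (x \<bullet> y)) * ?h y"
      by (intro AE_I2 lim)
    show "(\<lambda>y. A (x \<bullet> y) / of_real (chord (x \<bullet> y)) * ?h y) \<in> borel_measurable sphere_measure"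
      by (rule borel_measurable_integrable[OF int])
    show "(\<lambda>y. ?g i (x \<bullet> y) * ?h y) \<in> borel_measurable sphere_measure" for i
      by (intro borel_measurable_integrable integrable_sphere_measure continuous_on_mult
          continuous_on_comp_inner[OF g] h)
  qed
  moreover have "(LINT y|sphere_measure. ?g i (x \<bullet> y) * ?h y)
      = of_real (2 * pi) * integral {-1..1} (\<lambda>t. ?g i t * ?P t) * ?h x" for i
    by (rule integral_continuous_isotropic[OF g x iso])
  moreover have "(\<lambda>i. integral {-1..1} (\<lambda>t. ?g i t * ?P t)) \<longlonglongrightarrow> integral {-1..1} (\<lambda>t. A t / of_real (chord t) * ?P t)"
  proof -
    have cont: "continuous_on {-1..1} (\<lambda>t. A t * ?P t)"
      by (intro continuous_intros continuous_on_subset[OF A]) auto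
    then have "compact ((\<lambda>t. A t * ?P t) ` {-1..1})"
      by (intro compact_continuous_image) auto
    then obtain C where "\<forall>z \<in> (\<lambda>t. A t * ?P t) ` {-1..1}. norm z \<le> C"
      using compact_imp_bounded bounded_iff by blast
    then have C: "norm (A t * ?P t) \<le> C" if "t \<in> {-1..1}" for t
      using that by simp
    show ?thesis
    proof (rule Equivalence_Lebesgue_Henstock_Integration.dominated_convergence(2))
      show "(\<lambda>t. ?g i t * ?P t) integrable_on {-1..1}" for i
        by (intro integrable_continuous_interval continuous_on_mult g continuous_intros)
      show "(\<lambda>t. C * (1 / chord t)) integrable_on {-1..1}"
        using has_integral_mult_right[OF has_integral_inverse_chord, of C] by (rule has_integral_integrable)
      show "norm (?g i t * ?P t) \<le> C * (1 / chord t)" if t: "t \<in> {-1..1}" for i t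
      proof -
        have "chord t \<ge> 0" using t by (simp add: chord_def)
        have "norm (?g i t * ?P t) \<le> norm (A t / of_real (chord t) * ?P t)"
          using t by (intro le) auto
        also have "\<dots> = norm (A t * ?P t) * (1 / chord t)"
          using \<open>chord t \<ge> 0\<close> by (simp add: norm_mult norm_divide)
        also have "\<dots> \<le> C * (1 / chord t)"
          using C[OF t] \<open>chord t \<ge> 0\<close> by (intro mult_right_mono) auto
        finally show ?thesis .
      qed
    qed (rule lim)
  qed
  then have "(\<lambda>i. of_real (2 * pi) * integral {-1..1} (\<lambda>t. ?g i t * ?P t) * ?h x)
      \<longlonglongrightarrow> zonal_multiplier A n * ?h x"
    unfolding zonal_multiplier_def by (intro tendsto_intros)
  ultimately show ?thesis
    using LIMSEQ_unique by fastforce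
qed

section \<open>From isotropic forms to spherical harmonics\<close>

lemma continuous_on_coeff_quadratic_power:
  fixes f g h :: "'a::topological_space \<Rightarrow> complex"
  assumes "continuous_on S f" "continuous_on S g" "continuous_on S h"
  shows "continuous_on S (\<lambda>y. coeff ([:f y, g y, h y:] ^ n) l)"
proof (induction n arbitrary: l)
  case (Suc n)
  show ?case
    using assms Suc.IH
    by (cases l; cases "l - 1") (auto simp: coeff_pCons' intro!: continuous_intros)
qed (cases l; simp)

text \<open>The integral identity holds for the whole family of isotropic vectors
  \<open>(1 - w\<^sup>2, \<i> (1 + w\<^sup>2), 2 w)\<close>, hence for each coefficient in \<open>w\<close>.\<close>

lemma integral_weakly_singular_coeff:
  fixes A :: "real \<Rightarrow> complex" and n l :: nat
  assumes A: "continuous_on UNIV A" and x: "x \<in> sphere 0 1"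
  defines "q \<equiv> \<lambda>y l. coeff ([:Complex (y $ 1) (y $ 2), of_real (2 * y $ 3), - cnj (Complex (y $ 1) (y $ 2)):] ^ n) l"
  shows "integrable sphere_measure (\<lambda>y. A (x \<bullet> y) / of_real (chord (x \<bullet> y)) * q y l)" (is ?int)
    and "(LINT y|sphere_measure. A (x \<bullet> y) / of_real (chord (x \<bullet> y)) * q y l) = zonal_multiplier A n * q x l"
proof -
  let ?Q = "\<lambda>y::real^3. [:Complex (y $ 1) (y $ 2), of_real (2 * y $ 3), - cnj (Complex (y $ 1) (y $ 2)):]"
  let ?k = "\<lambda>y. A (x \<bullet> y) / of_real (chord (x \<bullet> y))"
  let ?I = "\<lambda>l. LINT y|sphere_measure. ?k y * q y l"
  have C: "continuous_on UNIV (\<lambda>y::real^3. Complex (y $ 1) (y $ 2))"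
    unfolding Complex_eq by (intro continuous_intros)
  have "continuous_on UNIV (\<lambda>y. q y l)" for l
    unfolding q_def by (intro continuous_on_coeff_quadratic_power continuous_intros C)
  then have int: "integrable sphere_measure (\<lambda>y. ?k y * q y l)" for l
    by (intro integrable_weakly_singular A x)
  then show ?int .
  have deg: "degree (?Q y ^ n) \<le> 2 * n" for y
  proof -
    have "degree (?Q y) \<le> 2" by (simp add: degree_pCons_le order.trans[OF degree_pCons_le])
    then have "degree (?Q y) * n \<le> 2 * n" by (rule mult_right_mono) simp
    then show ?thesis using degree_power_le[of "?Q y" n] by linarith
  qed
  have expand: "poly (?Q y ^ n) w = (\<Sum>l\<le>2 * n. q y l * w ^ l)" for y w
    unfolding q_def poly_altdef using deg[of y]
    by (intro sum.mono_neutral_left) (auto intro: coeff_eq_0)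
  have lf: "poly (?Q y ^ n) w = linear_form (1 - w\<^sup>2) (\<i> * (1 + w\<^sup>2)) (2 * w) y ^ n" for y w
    by (simp add: linear_form_def Complex_eq algebra_simps power2_eq_square)
  have iso: "(1 - w\<^sup>2)\<^sup>2 + (\<i> * (1 + w\<^sup>2))\<^sup>2 + (2 * w)\<^sup>2 = 0" for w
    by (simp add: algebra_simps power2_eq_square)
  let ?p = "\<Sum>l\<le>2 * n. monom (?I l) l"
  have "poly ?p w = poly (smult (zonal_multiplier A n) (?Q x ^ n)) w" for w
  proof -
    have "poly ?p w = (\<Sum>l\<le>2 * n. LINT y|sphere_measure. ?k y * q y l * w ^ l)"
      by (simp only: poly_sum poly_monom integral_mult_left_zero)
    also have "\<dots> = (LINT y|sphere_measure. (\<Sum>l\<le>2 * n. ?k y * q y l * w ^ l))"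
      by (intro Bochner_Integration.integral_sum[symmetric] integrable_mult_left int)
    also have "\<dots> = (LINT y|sphere_measure. ?k y * poly (?Q y ^ n) w)"
      by (simp only: expand sum_distrib_left mult.assoc)
    also have "\<dots> = zonal_multiplier A n * poly (?Q x ^ n) w"
      unfolding lf by (rule integral_weakly_singular_isotropic[OF A x iso])
    finally show ?thesis by simp
  qed
  then have "poly ?p = poly (smult (zonal_multiplier A n) (?Q x ^ n))" ..
  then have eq: "?p = smult (zonal_multiplier A n) (?Q x ^ n)"
    by (simp only: poly_eq_poly_eq_iff)
  show "?I l = zonal_multiplier A n * q x l"
  proof (cases "l \<le> 2 * n")
    case True
    from arg_cong[OF eq, of "\<lambda>p. coeff p l"] True show ?thesis
      by (simp add: coeff_sum q_def)
  next
    case False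
    then have "q y l = 0" for y
      unfolding q_def using deg[of y] by (intro coeff_eq_0) simp
    then show ?thesis by simp
  qed
qed

lemma sph_harmonic_cnj: "sph_harmonic n (- m) y = cnj (sph_harmonic n m y)"
  by (simp add: sph_harmonic_def exp_cnj)

lemma zonal_multiplier_cnj: "zonal_multiplier (\<lambda>t. cnj (A t)) n = cnj (zonal_multiplier A n)"
  by (simp add: zonal_multiplier_def Henstock_Kurzweil_Integration.integral_cnj)

text \<open>\<open>Arg\<close> is discontinuous, but away from 0 the phase is an integer power of
  \<open>sgn\<close>. Measurability on all of the space is wanted because the coefficient form of
  the harmonics is available on the sphere only.\<close>

lemma borel_measurable_sph_harmonic [measurable]: "sph_harmonic n m \<in> borel_measurable borel"
proof -
  let ?\<xi> = "\<lambda>y::real^3. Complex (y $ 1) (y $ 2)"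
  have "exp (\<i> * of_int m * of_real (Arg z)) = (if z = 0 then 1 else sgn z powi m)" for z
  proof -
    have "exp (\<i> * of_int m * of_real (Arg z)) = cis (Arg z) powi m"
      by (simp add: cis_conv_exp exp_power_int mult_ac)
    then show ?thesis by (auto simp: cis_Arg Arg_zero)
  qed
  then have "sph_harmonic n m = (\<lambda>y. of_real (sqrt ((2 * real n + 1) / (4 * pi) * (fact (n - nat \<bar>m\<bar>) / fact (n + nat \<bar>m\<bar>))) *
       assoc_legendre n (nat \<bar>m\<bar>) (y $ 3)) * (if ?\<xi> y = 0 then 1 else sgn (?\<xi> y) powi m))"
    unfolding sph_harmonic_def by (intro ext) (simp only:)
  moreover have [measurable]: "(\<lambda>y::real^3. assoc_legendre n (nat \<bar>m\<bar>) (y $ 3)) \<in> borel_measurable borel"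
    unfolding assoc_legendre_def by (intro borel_measurable_continuous_onI continuous_intros)
  moreover have [measurable]: "?\<xi> \<in> borel_measurable borel"
    unfolding Complex_eq by (intro borel_measurable_continuous_onI continuous_intros)
  ultimately show ?thesis
    unfolding sgn_div_norm power_int_def by (cases "m \<ge> 0") simp_all
qed

text \<open>Orders m \<le> 0 come from the coefficient identities; positive orders follow by
  conjugation, starting from the conjugate kernel.\<close>

theorem funk_hecke:
  fixes A :: "real \<Rightarrow> complex"
  assumes A: "continuous_on UNIV A" and x: "x \<in> sphere 0 1" and m: "\<bar>m\<bar> \<le> int n"
  shows "integrable sphere_measure (\<lambda>y. A (x \<bullet> y) / of_real (chord (x \<bullet> y)) * sph_harmonic n m y)"
    and "(LINT y|sphere_measure. A (x \<bullet> y) / of_real (chord (x \<bullet> y)) * sph_harmonic n m y)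
      = zonal_multiplier A n * sph_harmonic n m x"
proof -
  have neg: "has_bochner_integral sphere_measure
      (\<lambda>y. A (x \<bullet> y) / of_real (chord (x \<bullet> y)) * sph_harmonic n (- int j) y)
      (zonal_multiplier A n * sph_harmonic n (- int j) x)"
    if A: "continuous_on UNIV A" and j: "j \<le> n" for A j
  proof -
    let ?q = "\<lambda>y. coeff ([:Complex (y $ 1) (y $ 2), of_real (2 * y $ 3), - cnj (Complex (y $ 1) (y $ 2)):] ^ n) (n + j)"
    define \<gamma> where "\<gamma> = complex_of_real (sqrt ((2 * real n + 1) / (4 * pi) * (fact (n - j) / fact (n + j))) *
       ((-1) ^ j * fact (n + j) / (2 ^ n * fact n)))"
    have Y: "sph_harmonic n (- int j) y = \<gamma> * ?q y" if "norm y = 1" for y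
      using sph_harmonic_eq_coeff[of y j n] that j by (simp add: \<gamma>_def)
    have [measurable]: "A \<in> borel_measurable borel" "chord \<in> borel_measurable borel"
      using A by (auto intro!: borel_measurable_continuous_onI continuous_intros)
    have hb: "has_bochner_integral sphere_measure
        (\<lambda>y. \<gamma> * (A (x \<bullet> y) / of_real (chord (x \<bullet> y)) * ?q y)) (\<gamma> * (zonal_multiplier A n * ?q x))"
      using integral_weakly_singular_coeff[OF A x, of n "n + j"]
      by (intro has_bochner_integral_mult_right) (simp add: has_bochner_integral_iff)
    have eq: "\<gamma> * (zonal_multiplier A n * ?q x) = zonal_multiplier A n * sph_harmonic n (- int j) x"
      using Y[of x] x by simp
    \<comment> \<open>The two integrands agree on the sphere, which carries the whole
      measure.\<close>
    have ae: "AE y in sphere_measure. \<gamma> * (A (x \<bullet> y) / of_real (chord (x \<bullet> y)) * ?q y)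
        = A (x \<bullet> y) / of_real (chord (x \<bullet> y)) * sph_harmonic n (- int j) y"
      using AE_sphere_measure by eventually_elim (simp add: Y)
    have meas: "(\<lambda>y. A (x \<bullet> y) / of_real (chord (x \<bullet> y)) * sph_harmonic n (- int j) y) \<in> borel_measurable sphere_measure"
      by measurable
    show ?thesis
      using hb unfolding has_bochner_integral_cong_AE[OF borel_measurable_has_bochner_integral[OF hb] meas ae] eq .
  qed
  have "has_bochner_integral sphere_measure
      (\<lambda>y. A (x \<bullet> y) / of_real (chord (x \<bullet> y)) * sph_harmonic n m y) (zonal_multiplier A n * sph_harmonic n m x)"
  proof (cases "m \<le> 0")
    case True
    then have "m = - int (nat (- m))" "nat (- m) \<le> n" using m by auto
    then show ?thesis using neg[OF A] by metis
  next
    case False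
    then have m: "m = int (nat m)" "nat m \<le> n" using m by auto
    have "continuous_on UNIV (\<lambda>t. cnj (A t))"
      by (intro continuous_intros A)
    from has_bochner_integral_cnj[OF neg[OF this m(2)]] show ?thesis
      using False by (simp add: zonal_multiplier_cnj flip: sph_harmonic_cnj)
  qed
  then show "integrable sphere_measure (\<lambda>y. A (x \<bullet> y) / of_real (chord (x \<bullet> y)) * sph_harmonic n m y)"
    and "(LINT y|sphere_measure. A (x \<bullet> y) / of_real (chord (x \<bullet> y)) * sph_harmonic n m y)
      = zonal_multiplier A n * sph_harmonic n m x"
    by (simp_all add: has_bochner_integral_iff)
qed

section \<open>The Neumann-Poincare operator\<close>

text \<open>What is left of the kernel on the sphere once the singular factor 1 /
  \<open>chord\<close> is split off.\<close>

definition np_density :: "real \<Rightarrow> real \<Rightarrow> complex" where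
  "np_density k t = (1 - \<i> * of_real (k * chord t)) * exp (\<i> * of_real (k * chord t)) / of_real (8 * pi)"

lemma continuous_on_np_density: "continuous_on A (np_density k)"
  unfolding np_density_def by (intro continuous_intros) auto

text \<open>The radial derivative D of G_k is of order 1 / r^2 for small r. The directional factor x
  \<bullet> (x - y) / r equals r / 2, since 1 - x \<bullet> y = r^2 / 2 on the unit sphere, and this
  extra r makes the kernel only weakly singular.\<close>

lemma np_kernel_eq:
  assumes x: "norm x = 1" and y: "norm y = 1" and "x \<noteq> y"
  shows "np_kernel k x y = np_density k (x \<bullet> y) / of_real (chord (x \<bullet> y))"
proof -
  define r where "r = norm (x - y)"
  have r: "r > 0" "chord (x \<bullet> y) = r"
    using assms(3) dist_sphere_eq_chord[OF x y, symmetric] unfolding r_def dist_norm by (simp, simp only:)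
  define D where "D = exp (\<i> * of_real (k * r)) * (1 - \<i> * of_real (k * r)) / of_real (4 * pi * r\<^sup>2)"
  have "((\<lambda>w. - exp (\<i> * of_real k * w) / (of_real (4 * pi) * w)) has_field_derivative D) (at (of_real r))"
    using r unfolding D_def
    by (auto intro!: derivative_eq_intros simp: field_simps power2_eq_square)
  from has_vector_derivative_real_field[OF this]
  have "((\<lambda>s. - exp (\<i> * of_real (k * s)) / of_real (4 * pi * s)) has_vector_derivative D) (at r)"
    by (simp add: mult.assoc)
  then have "((\<lambda>s. - exp (\<i> * of_real (k * s)) / of_real (4 * pi * s)) has_derivative (\<lambda>h. h *\<^sub>R D)) (at (norm (x - y)))"
    by (simp add: has_vector_derivative_def r_def)
  moreover have "((\<lambda>z. norm (z - y)) has_derivative (\<lambda>h. h \<bullet> sgn (x - y))) (at x)"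
  proof -
    have "(norm has_derivative (\<lambda>h. h \<bullet> sgn (x - y))) (at (x - y))"
      using has_derivative_norm[of "x - y"] assms by simp
    moreover have "((\<lambda>z. z - y) has_derivative (\<lambda>h. h)) (at x)"
      by (auto intro!: derivative_eq_intros)
    ultimately show ?thesis
      by (rule has_derivative_compose[rotated])
  qed
  ultimately have "((\<lambda>z. - exp (\<i> * of_real (k * norm (z - y))) / of_real (4 * pi * norm (z - y)))
      has_derivative (\<lambda>h. (h \<bullet> sgn (x - y)) *\<^sub>R D)) (at x)"
    by (rule has_derivative_compose[rotated])
  then have "(\<lambda>h. (h \<bullet> sgn (x - y)) *\<^sub>R D) = frechet_derivative (\<lambda>z. helmholtz_G k (z - y)) (at x)"
    unfolding helmholtz_G_def by (rule frechet_derivative_at)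
  then have "np_kernel k x y = (x \<bullet> sgn (x - y)) *\<^sub>R D"
    by (simp add: np_kernel_def unit_ball_normal_def fun_eq_iff)
  also have "x \<bullet> sgn (x - y) = r / 2"
  proof -
    have "r\<^sup>2 / 2 = 1 - x \<bullet> y"
      using r(2) inner_sphere_le_1[OF x y] by (auto simp: chord_def)
    moreover have "x \<bullet> (x - y) = 1 - x \<bullet> y"
      using x by (simp add: inner_diff_right norm_eq_1)
    moreover have "x \<bullet> sgn (x - y) = (x \<bullet> (x - y)) / r"
      unfolding sgn_div_norm r_def[symmetric] inner_scaleR_right by (simp only: divide_inverse mult.commute)
    ultimately have "x \<bullet> sgn (x - y) = r\<^sup>2 / 2 / r" by (simp only:)
    then show ?thesis
      using r(1) by (simp add: power2_eq_square)
  qed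
  also have "(r / 2) *\<^sub>R D = np_density k (x \<bullet> y) / of_real (chord (x \<bullet> y))"
    using r by (simp add: D_def np_density_def scaleR_conv_of_real field_simps power2_eq_square)
  finally show ?thesis .
qed

text \<open>The substitution r = chord t, with t = 1 - r^2 / 2 and dr = - dt / r, reduces this to
  \<open>integral_exp_legendre_eq_hankel\<close>.\<close>

lemma has_integral_exp_chord_legendre:
  fixes k :: real
  assumes "0 < k"
  shows "((\<lambda>t. exp (\<i> * of_real (k * chord t)) * of_real (poly (legendre_poly n) t) / of_real (chord t)) has_integral
     2 * \<i> * of_real k * (of_real (sph_bessel_j n k) * sph_hankel_1 n k)) {-1..1}"
proof -
  let ?f = "\<lambda>r. exp (\<i> * of_real (k * r)) * of_real (poly (legendre_poly n) (1 - r\<^sup>2 / 2)) :: complex"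
  have chord: "chord (-1) = 2" "chord 1 = 0" by (simp_all add: chord_def)
  have "((\<lambda>t. (- 1 / chord t) *\<^sub>R ?f (chord t)) has_integral
      (integral {chord (-1)..chord 1} ?f - integral {chord 1..chord (-1)} ?f)) {-1..1}"
  \<comment> \<open>The exceptional point is t = 1, where \<open>chord\<close> is continuous but not
    differentiable.\<close>
  proof (rule has_integral_substitution_general[where s = "{1}" and c = 0 and d = 2])
    show "chord ` {-1..1} \<subseteq> {0..2}"
    proof
      fix r assume "r \<in> chord ` {-1..1}"
      then obtain t where t: "r = chord t" "t \<in> {-1..1}" by blast
      then have "sqrt (2 * (1 - t)) \<le> sqrt (2\<^sup>2)"
        by (intro real_sqrt_le_mono) auto
      with t show "r \<in> {0..2}" by (simp add: chord_def)
    qed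
    show "(chord has_field_derivative - 1 / chord t) (at t within {-1..1})" if "t \<in> {-1..1} - {1}" for t
      using that by (intro chord_deriv) auto
  qed (auto intro!: continuous_intros)
  from has_integral_neg[OF this]
  have I: "((\<lambda>t. (1 / chord t) *\<^sub>R ?f (chord t)) has_integral integral {0..2} ?f) {-1..1}"
    by (simp add: chord)
  have V: "integral {0..2} ?f = 2 * \<i> * of_real k * (of_real (sph_bessel_j n k) * sph_hankel_1 n k)"
    by (rule integral_unique[OF integral_exp_legendre_eq_hankel[OF assms]])
  have E: "(1 / chord t) *\<^sub>R ?f (chord t)
      = exp (\<i> * of_real (k * chord t)) * of_real (poly (legendre_poly n) t) / of_real (chord t)" if "t \<in> {-1..1}" for t
  proof -
    have "1 - (chord t)\<^sup>2 / 2 = t" using that by (simp add: chord_def diff_divide_distrib)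
    then show ?thesis by (simp add: scaleR_conv_of_real)
  qed
  show ?thesis
    by (rule has_integral_eq[OF E I[unfolded V]])
qed

text \<open>(1 - i k r) / r = 1 / r - i k splits the integral: the first part gives the Hankel
  product, the second is a multiple of \<open>c_const\<close>. The common weight is 2 pi / (8 pi) =
  1/4.\<close>

lemma zonal_multiplier_np_density:
  fixes k :: real
  assumes "0 < k"
  shows "zonal_multiplier (np_density k) n
    = \<i> * of_real k / 2 * (of_real (sph_bessel_j n k) * sph_hankel_1 n k + c_const n k)"
proof -
  let ?e = "\<lambda>t. exp (\<i> * of_real (k * chord t)) * of_real (poly (legendre_poly n) t) :: complex"
  let ?jh = "of_real (sph_bessel_j n k) * sph_hankel_1 n k"
  have "(?e has_integral integral {-1..1} ?e) {-1..1}"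
    by (intro integrable_integral integrable_continuous_interval continuous_intros)
  from has_integral_diff[OF has_integral_exp_chord_legendre[OF assms, of n] has_integral_mult_right[OF this, of "\<i> * of_real k"]]
  have "((\<lambda>t. ?e t / of_real (chord t) - \<i> * of_real k * ?e t) has_integral
      2 * \<i> * of_real k * ?jh - \<i> * of_real k * integral {-1..1} ?e) {-1..1}" .
  from has_integral_mult_right[OF this, of "1 / of_real (8 * pi)"]
  have I: "((\<lambda>t. np_density k t / of_real (chord t) * of_real (poly (legendre_poly n) t)) has_integral
      1 / of_real (8 * pi) * (2 * \<i> * of_real k * ?jh - \<i> * of_real k * integral {-1..1} ?e)) {-1..1}"
  \<comment> \<open>At t = 1 division by 0 turns the whole left side into 0, but only one of the two
    summands on the right; this point is therefore excepted.\<close>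
  proof (rule has_integral_spike_finite[rotated 2])
    fix t :: real assume "t \<in> {-1..1} - {1}"
    then have "chord t \<noteq> 0" by (simp add: chord_def)
    then show "np_density k t / of_real (chord t) * of_real (poly (legendre_poly n) t)
        = 1 / of_real (8 * pi) * (?e t / of_real (chord t) - \<i> * of_real k * ?e t)"
      by (simp add: np_density_def field_simps)
  qed simp
  have c: "c_const n k = - (1 / 2) * integral {-1..1} ?e"
    by (simp add: c_const_def chord_def)
  show ?thesis
    unfolding zonal_multiplier_def integral_unique[OF I] c by (simp add: field_simps)
qed

section \<open>Principal values of integrable kernels\<close>

lemma sets_pv_region: "pv_region x \<epsilon> \<in> sets borel"
proof -
  have "pv_region x \<epsilon> = sphere 0 1 \<inter> {y. \<epsilon> \<le> dist x y}"
    by (auto simp: pv_region_def)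
  moreover have "closed {y. \<epsilon> \<le> dist x y}"
    by (intro closed_Collect_le continuous_intros)
  ultimately show ?thesis by (simp add: closed_Int borel_closed)
qed

text \<open>For an integrable kernel the truncated integrals converge by dominated convergence. The
  truncations never see y = x, so f may be arbitrary there; g x = 0 makes the truncated integrands
  converge at that point as well, without an appeal to its measure.\<close>

lemma pv_integral_of_integrable:
  fixes f g :: "real^3 \<Rightarrow> complex"
  assumes g: "integrable sphere_measure g" and "g x = 0"
    and eq: "\<And>y. y \<in> sphere 0 1 \<Longrightarrow> y \<noteq> x \<Longrightarrow> f y = g y"
  shows "pv_exists f x" and "pv_integral f x = (LINT y|sphere_measure. g y)"
proof -
  have ind: "indicator (pv_region x \<epsilon>) y *\<^sub>R f y = indicator (pv_region x \<epsilon>) y *\<^sub>R g y" if "\<epsilon> > 0" for \<epsilon> y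
    using eq[of y] that by (cases "y = x") (auto simp: indicator_def pv_region_def)
  have int: "integrable sphere_measure (\<lambda>y. indicator (pv_region x \<epsilon>) y *\<^sub>R g y)" for \<epsilon>
    using sets_pv_region by (intro integrable_mult_indicator g) simp
  have "((\<lambda>\<epsilon>. LINT y|sphere_measure. indicator (pv_region x \<epsilon>) y *\<^sub>R g y) \<longlongrightarrow> (LINT y|sphere_measure. g y)) (at_right 0)"
    unfolding tendsto_at_iff_sequentially o_def
  proof (intro allI impI)
    fix X :: "nat \<Rightarrow> real" assume X: "\<forall>i. X i \<in> {0<..} - {0}" "X \<longlonglongrightarrow> 0"
    show "(\<lambda>i. LINT y|sphere_measure. indicator (pv_region x (X i)) y *\<^sub>R g y) \<longlonglongrightarrow> (LINT y|sphere_measure. g y)"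
    proof (rule integral_dominated_convergence)
      show "integrable sphere_measure (\<lambda>y. norm (g y))"
        by (intro integrable_norm g)
      show "g \<in> borel_measurable sphere_measure"
        using g by (rule borel_measurable_integrable)
      show "(\<lambda>y. indicator (pv_region x (X i)) y *\<^sub>R g y) \<in> borel_measurable sphere_measure" for i
        using int by (rule borel_measurable_integrable)
      show "AE y in sphere_measure. norm (indicator (pv_region x (X i)) y *\<^sub>R g y) \<le> norm (g y)" for i
        by (auto simp: indicator_def)
      show "AE y in sphere_measure. (\<lambda>i. indicator (pv_region x (X i)) y *\<^sub>R g y) \<longlonglongrightarrow> g y"
        using AE_sphere_measure
      proof eventually_elim
        case (elim y)
        show ?case
        proof (cases "y = x")
          case True
          then show ?thesis using assms(2) by simp
        next
          case False
          then have "0 < dist x y" by simp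
          with X(2) have "\<forall>\<^sub>F i in sequentially. X i < dist x y"
            by (rule order_tendstoD)
          then have "\<forall>\<^sub>F i in sequentially. indicator (pv_region x (X i)) y *\<^sub>R g y = g y"
            by eventually_elim (simp add: pv_region_def elim)
          then show ?thesis by (rule tendsto_eventually)
        qed
      qed
    qed
  qed
  moreover have "\<forall>\<^sub>F \<epsilon> in at_right 0. (LINT y|sphere_measure. indicator (pv_region x \<epsilon>) y *\<^sub>R g y)
      = (LINT y:pv_region x \<epsilon>|sphere_measure. f y)"
    using eventually_at_right_less[of 0]
    by eventually_elim (simp add: set_lebesgue_integral_def ind)
  ultimately have lim: "((\<lambda>\<epsilon>. LINT y:pv_region x \<epsilon>|sphere_measure. f y) \<longlongrightarrow> (LINT y|sphere_measure. g y)) (at_right 0)"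
    by (rule Lim_transform_eventually)
  have "set_integrable sphere_measure (pv_region x \<epsilon>) f" if "\<epsilon> > 0" for \<epsilon>
    unfolding set_integrable_def ind[OF that] by (rule int)
  then show "pv_exists f x"
    unfolding pv_exists_def using lim by blast
  show "pv_integral f x = (LINT y|sphere_measure. g y)"
    unfolding pv_integral_def by (rule tendsto_Lim[OF _ lim]) simp
qed

theorem lemma2p5:
  fixes k :: real and n :: nat and m :: int
  assumes "k > 0" and "- int n \<le> m" and "m \<le> int n"
  shows "\<forall>x \<in> sphere 0 1.
    np_defined_at k (sph_harmonic n m) x \<and>
    np_operator k (sph_harmonic n m) x =
      \<i> * of_real k / 2 * (of_real (sph_bessel_j n k) * sph_hankel_1 n k + c_const n k) *
      sph_harmonic n m x"
proof
  fix x :: "real^3" assume x: "x \<in> sphere 0 1"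
  let ?g = "\<lambda>y. np_density k (x \<bullet> y) / of_real (chord (x \<bullet> y)) * sph_harmonic n m y"
  let ?f = "\<lambda>y. np_kernel k x y * sph_harmonic n m y"
  have m: "\<bar>m\<bar> \<le> int n" using assms by simp
  note fh = funk_hecke[OF continuous_on_np_density x m, of k]
  have "x \<bullet> x = 1" using x by (simp add: norm_eq_1)
  \<comment> \<open>The chord from x to itself has length 0, and division by 0 gives 0.\<close>
  then have "?g x = 0" by (simp add: chord_def)
  moreover have "?f y = ?g y" if "y \<in> sphere 0 1" "y \<noteq> x" for y
    using np_kernel_eq[of x y k] x that by auto
  ultimately have "pv_exists ?f x" "pv_integral ?f x = (LINT y|sphere_measure. ?g y)"
    using pv_integral_of_integrable[OF fh(1), of x ?f] by blast+
  then show "np_defined_at k (sph_harmonic n m) x \<and>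
    np_operator k (sph_harmonic n m) x =
      \<i> * of_real k / 2 * (of_real (sph_bessel_j n k) * sph_hankel_1 n k + c_const n k) *
      sph_harmonic n m x"
    unfolding np_defined_at_def np_operator_def fh(2) zonal_multiplier_np_density[OF assms(1)] by simp
qed

end
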